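(* Let $V$ be a non-trivial irreducible integrable $\tau(B)$-module with finite dimensional weight spaces with respect to $H$ such that all $K_i$ ($0\le i\le n$) act trivially on $V$. Then $Z\otimes B$ acts trivially on $V$.
   Context: Everything is over $\mathbb C$. $\dot{\mathfrak g}$ is a finite dimensional simple Lie algebra with Cartan subalgebra $\dot{\mathfrak h}$, root system $\dot\Delta$, and normalized invariant non-degenerate symmetric bilinear form $(\cdot,\cdot)$. $n\ge 1$ is an integer and $B$ is a commutative associative finitely generated unital $\mathbb C$-algebra. $A=\mathbb C[t_0^{\pm1},\dots,t_n^{\pm1}]$, $t^{\underline m}=t_1^{m_1}\cdots t_n^{m_n}$ for $\underline m\in\mathbb Z^n$. $\Omega_A$ is the vector space with basis $t_0^{k_0}t^{\underline k}K_i$ ($0\le i\le n$, $k_0\in\mathbb Z$, $\underline k\in\mathbb Z^n$), $dA$ is the span of the elements $\sum_{i=0}^n k_i t_0^{k_0}t^{\underline k}K_i$, and $Z=\Omega_A/dA$. $\tau_0=\dot{\mathfrak g}\otimes A\oplus Z$ with $Z$ central and $[x\otimes t_0^{k_0}t^{\underline k},y\otimes t_0^{r_0}t^{\underline r}]=[x,y]\otimes t_0^{k_0+r_0}t^{\underline k+\underline r}+(x,y)\sum_{i=0}^n k_i t_0^{k_0+r_0}t^{\underline k+\underline r}K_i$. $\tau(B)=\tau_0\otimes B\oplus D$, $D=\mathrm{span}\{d_0,\dots,d_n\}$, with $[x\otimes b,y\otimes b']=[x,y]\otimes bb'$, $[d_i,x\otimes t_0^{k_0}t^{\underline k}\otimes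 b]=k_i\,x\otimes t_0^{k_0}t^{\underline k}\otimes b$, $[d_i,t_0^{k_0}t^{\underline k}K_j\otimes b]=k_i\,t_0^{k_0}t^{\underline k}K_j\otimes b$, $[d_i,d_j]=0$. $K_i$ and $\dot{\mathfrak h}$ are identified with $K_i\otimes 1$ and $\dot{\mathfrak h}\otimes1\otimes1$; $H=\dot{\mathfrak h}\oplus\bigoplus_i\mathbb CK_i\oplus\bigoplus_i\mathbb Cd_i$. A $\tau(B)$-module $V$ is integrable if $V=\bigoplus_{\lambda\in H^*}V_\lambda$ with $V_\lambda=\{v:hv=\lambda(h)v\ \forall h\in H\}$ (weight spaces), and for all $\alpha\in\dot\Delta$, $(m_0,\underline m)\in\mathbb Z^{n+1}$, $b\in B$, $v\in V$ there is $k$ with $(X_\alpha\otimes t_0^{m_0}t^{\underline m}\otimes b)^k v=0$, where $X_\alpha$ is a root vector of root $\alpha$. *)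

theory Defs
  imports "HOL-Analysis.Analysis" "HOL-Library.Poly_Mapping"
begin

section \<open>Complex vector spaces, Lie algebras and commutative algebras\<close>

class complex_vector = ab_group_add +
  fixes scaleC :: "complex \<Rightarrow> 'a \<Rightarrow> 'a" (infixr "*\<^sub>C" 75)
  assumes scaleC_add_right: "a *\<^sub>C (x + y) = a *\<^sub>C x + a *\<^sub>C y"
    and scaleC_add_left: "(a + b) *\<^sub>C x = a *\<^sub>C x + b *\<^sub>C x"
    and scaleC_scaleC: "a *\<^sub>C b *\<^sub>C x = (a * b) *\<^sub>C x"
    and scaleC_one: "1 *\<^sub>C x = x"

global_interpretation cvs: vector_space "scaleC :: complex \<Rightarrow> 'a \<Rightarrow> 'a::complex_vector"
  by standard (simp_all add: scaleC_add_right scaleC_add_left scaleC_scaleC scaleC_one)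

abbreviation clinear :: "('a::complex_vector \<Rightarrow> 'b::complex_vector) \<Rightarrow> bool" where
  "clinear \<equiv> Vector_Spaces.linear scaleC scaleC"

definition cbilinear ::
    "('a::complex_vector \<Rightarrow> 'b::complex_vector \<Rightarrow> 'c::complex_vector) \<Rightarrow> bool" where
  "cbilinear f \<longleftrightarrow> (\<forall>x. clinear (f x)) \<and> (\<forall>y. clinear (\<lambda>x. f x y))"

definition finite_dimC :: "'a::complex_vector set \<Rightarrow> bool" where
  "finite_dimC W \<longleftrightarrow> (\<exists>S. finite S \<and> W \<subseteq> cvs.span S)"

class complex_lie_algebra = complex_vector +
  fixes lie :: "'a \<Rightarrow> 'a \<Rightarrow> 'a"
  assumes lie_add_left: "lie (x + y) z = lie x z + lie y z"
    and lie_add_right: "lie x (y + z) = lie x y + lie x z"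
    and lie_scaleC_left: "lie (c *\<^sub>C x) y = c *\<^sub>C lie x y"
    and lie_scaleC_right: "lie x (c *\<^sub>C y) = c *\<^sub>C lie x y"
    and lie_self: "lie x x = 0"
    and lie_jacobi: "lie x (lie y z) + lie y (lie z x) + lie z (lie x y) = 0"

class complex_comm_algebra = complex_vector + comm_ring_1 +
  assumes scaleC_mult_left: "(c *\<^sub>C x) * y = c *\<^sub>C (x * y)"

inductive_set alg_generated :: "'b::complex_comm_algebra set \<Rightarrow> 'b set"
  for S :: "'b::complex_comm_algebra set" where
  gen: "x \<in> S \<Longrightarrow> x \<in> alg_generated S"
| one: "1 \<in> alg_generated S"
| add: "x \<in> alg_generated S \<Longrightarrow> y \<in> alg_generated S \<Longrightarrow> x + y \<in> alg_generated S"
| mult: "x \<in> alg_generated S \<Longrightarrow> y \<in> alg_generated S \<Longrightarrow> x * y \<in> alg_generated S"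
| scale: "x \<in> alg_generated S \<Longrightarrow> c *\<^sub>C x \<in> alg_generated S"

definition finitely_generated_algebra :: "'b::complex_comm_algebra itself \<Rightarrow> bool" where
  "finitely_generated_algebra _ \<longleftrightarrow> (\<exists>S :: 'b set. finite S \<and> alg_generated S = UNIV)"

subsection \<open>Vector space structures on standard types\<close>

instantiation complex :: complex_comm_algebra
begin
definition scaleC_complex :: "complex \<Rightarrow> complex \<Rightarrow> complex" where
  "scaleC_complex c x = c * x"
instance by standard (simp_all add: scaleC_complex_def algebra_simps)
end

instantiation prod :: (complex_vector, complex_vector) complex_vector
begin
definition scaleC_prod :: "complex \<Rightarrow> 'a \<times> 'b \<Rightarrow> 'a \<times> 'b" where
  "scaleC_prod c p = (c *\<^sub>C fst p, c *\<^sub>C snd p)"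
instance
  by standard (simp_all add: scaleC_prod_def prod_eq_iff scaleC_add_right scaleC_add_left
      scaleC_scaleC scaleC_one)
end

instantiation vec :: (complex_vector, finite) complex_vector
begin
definition scaleC_vec :: "complex \<Rightarrow> ('a, 'b) vec \<Rightarrow> ('a, 'b) vec" where
  "scaleC_vec c x = (\<chi> i. c *\<^sub>C (x $ i))"
instance
  by standard (simp_all add: scaleC_vec_def vec_eq_iff scaleC_add_right scaleC_add_left
      scaleC_scaleC scaleC_one)
end

instantiation poly_mapping :: (type, complex_vector) complex_vector
begin
lift_definition scaleC_poly_mapping :: "complex \<Rightarrow> ('a \<Rightarrow>\<^sub>0 'b) \<Rightarrow> 'a \<Rightarrow>\<^sub>0 'b"
  is "\<lambda>c f k. c *\<^sub>C f k"
  by (rule finite_subset[rotated], assumption) (auto)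
instance
  by standard (transfer, simp add: fun_eq_iff scaleC_add_right scaleC_add_left
      scaleC_scaleC scaleC_one)+
end

lemma lookup_scaleC [simp]:
  "Poly_Mapping.lookup (c *\<^sub>C p) k = c *\<^sub>C Poly_Mapping.lookup p k"
  by (simp add: scaleC_poly_mapping.rep_eq)

definition lin_ext :: "('i \<Rightarrow> 'a::complex_vector) \<Rightarrow> ('i \<Rightarrow>\<^sub>0 complex) \<Rightarrow> 'a" where
  "lin_ext f p = (\<Sum>k\<in>Poly_Mapping.keys p. Poly_Mapping.lookup p k *\<^sub>C f k)"

lemma clinear_iff:
  "clinear f \<longleftrightarrow> (\<forall>x y. f (x + y) = f x + f y) \<and> (\<forall>c x. f (c *\<^sub>C x) = c *\<^sub>C f x)"
  by (simp add: Vector_Spaces.linear_iff cvs.vector_space_axioms)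

lemma lin_ext_superset:
  assumes "finite S" "Poly_Mapping.keys p \<subseteq> S"
  shows "lin_ext f p = (\<Sum>k\<in>S. Poly_Mapping.lookup p k *\<^sub>C f k)"
  unfolding lin_ext_def using assms
  by (intro sum.mono_neutral_left) (auto simp: in_keys_iff)

lemma lin_ext_add: "lin_ext f (p + q) = lin_ext f p + lin_ext f q"
proof -
  let ?S = "Poly_Mapping.keys p \<union> Poly_Mapping.keys q"
  have *: "finite ?S" "Poly_Mapping.keys (p + q) \<subseteq> ?S"
    by (auto simp: keys_add)
  show ?thesis
    by (simp add: lin_ext_superset[OF *] lin_ext_superset[OF *(1), of p]
        lin_ext_superset[OF *(1), of q] lookup_add scaleC_add_left sum.distrib)
qed

lemma lin_ext_scaleC: "lin_ext f (c *\<^sub>C p) = c *\<^sub>C lin_ext f p"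
proof -
  have *: "finite (Poly_Mapping.keys p)" "Poly_Mapping.keys (c *\<^sub>C p) \<subseteq> Poly_Mapping.keys p"
    by (auto simp: in_keys_iff scaleC_complex_def)
  show ?thesis
    by (simp add: lin_ext_superset[OF *] lin_ext_superset[OF *(1), of p]
        cvs.scale_sum_right scaleC_scaleC scaleC_complex_def)
qed

lemma clinear_lin_ext: "clinear (lin_ext f)"
  by (simp add: clinear_iff lin_ext_add lin_ext_scaleC)

lemma lin_ext_single [simp]: "lin_ext f (Poly_Mapping.single k c) = c *\<^sub>C f k"
  by (simp add: lin_ext_def)

section \<open>Tensor products over the complex numbers\<close>

text \<open>The quotient of the free vector space on \<^typ>\<open>'a \<times> 'b\<close> by the bilinearity relations.\<close>

definition tensor_relations ::
    "(('a::complex_vector \<times> 'b::complex_vector) \<Rightarrow>\<^sub>0 complex) set" where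
  "tensor_relations = cvs.span (
     (let e = (\<lambda>x y. Poly_Mapping.single (x, y) 1) in
        {e (x + x') y - (e x y + e x' y) | x x' y. True}
      \<union> {e x (y + y') - (e x y + e x y') | x y y'. True}
      \<union> {e (c *\<^sub>C x) y - c *\<^sub>C e x y | c x y. True}
      \<union> {e x (c *\<^sub>C y) - c *\<^sub>C e x y | c x y. True}))"

lemma equivp_subspace:
  assumes "cvs.subspace W"
  shows "equivp (\<lambda>u v. u - v \<in> W)"
proof (rule equivpI)
  show "reflp (\<lambda>u v. u - v \<in> W)"
    using assms by (simp add: reflp_def cvs.subspace_0)
  show "symp (\<lambda>u v. u - v \<in> W)"
  proof (rule sympI)
    fix x y assume "x - y \<in> W"
    then have "- (x - y) \<in> W" by (rule cvs.subspace_neg[OF assms])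
    then show "y - x \<in> W" by simp
  qed
  show "transp (\<lambda>u v. u - v \<in> W)"
  proof (rule transpI)
    fix x y z assume "x - y \<in> W" "y - z \<in> W"
    then have "(x - y) + (y - z) \<in> W" by (rule cvs.subspace_add[OF assms])
    then show "x - z \<in> W" by simp
  qed
qed

quotient_type (overloaded) ('a, 'b) tensor =
    "('a::complex_vector \<times> 'b::complex_vector) \<Rightarrow>\<^sub>0 complex"
  / "\<lambda>u v. u - v \<in> tensor_relations"
  by (rule equivp_subspace) (simp add: tensor_relations_def)

lemma subspace_tensor_relations: "cvs.subspace tensor_relations"
  by (simp add: tensor_relations_def)

instantiation tensor :: (complex_vector, complex_vector) complex_vector
begin

lift_definition zero_tensor :: "('a, 'b) tensor" is 0 .

lift_definition plus_tensor :: "('a, 'b) tensor \<Rightarrow> ('a, 'b) tensor \<Rightarrow> ('a, 'b) tensor" is "(+)"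
proof -
  fix u v u' v' :: "('a \<times> 'b) \<Rightarrow>\<^sub>0 complex"
  assume "u - v \<in> tensor_relations" "u' - v' \<in> tensor_relations"
  then have "(u - v) + (u' - v') \<in> tensor_relations"
    by (rule cvs.subspace_add[OF subspace_tensor_relations])
  then show "(u + u') - (v + v') \<in> tensor_relations"
    by (simp add: algebra_simps)
qed

lift_definition uminus_tensor :: "('a, 'b) tensor \<Rightarrow> ('a, 'b) tensor" is "uminus"
proof -
  fix u v :: "('a \<times> 'b) \<Rightarrow>\<^sub>0 complex"
  assume "u - v \<in> tensor_relations"
  then have "- (u - v) \<in> tensor_relations"
    by (rule cvs.subspace_neg[OF subspace_tensor_relations])
  then show "- u - - v \<in> tensor_relations" by simp
qed

lift_definition minus_tensor :: "('a, 'b) tensor \<Rightarrow> ('a, 'b) tensor \<Rightarrow> ('a, 'b) tensor" is "(-)"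
proof -
  fix u v u' v' :: "('a \<times> 'b) \<Rightarrow>\<^sub>0 complex"
  assume "u - v \<in> tensor_relations" "u' - v' \<in> tensor_relations"
  then have "(u - v) - (u' - v') \<in> tensor_relations"
    by (rule cvs.subspace_diff[OF subspace_tensor_relations])
  then show "(u - u') - (v - v') \<in> tensor_relations"
    by (simp add: algebra_simps)
qed

lift_definition scaleC_tensor :: "complex \<Rightarrow> ('a, 'b) tensor \<Rightarrow> ('a, 'b) tensor" is "scaleC"
proof -
  fix c and u v :: "('a \<times> 'b) \<Rightarrow>\<^sub>0 complex"
  assume "u - v \<in> tensor_relations"
  then have "c *\<^sub>C (u - v) \<in> tensor_relations"
    by (rule cvs.subspace_scale[OF subspace_tensor_relations])
  then show "c *\<^sub>C u - c *\<^sub>C v \<in> tensor_relations"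
    by (simp only: cvs.scale_right_diff_distrib)
qed

instance
proof
  note subspace_tensor_relations [THEN cvs.subspace_0, simp]
  fix a b c :: "('a, 'b) tensor" and k l :: complex
  show "a + b + c = a + (b + c)" by transfer (simp add: add.assoc)
  show "a + b = b + a" by transfer (simp add: add.commute)
  show "0 + a = a" by transfer simp
  show "- a + a = 0" by transfer simp
  show "a - b = a + - b" by transfer simp
  show "k *\<^sub>C (a + b) = k *\<^sub>C a + k *\<^sub>C b" by transfer (simp add: scaleC_add_right)
  show "(k + l) *\<^sub>C a = k *\<^sub>C a + l *\<^sub>C a" by transfer (simp add: scaleC_add_left)
  show "k *\<^sub>C l *\<^sub>C a = (k * l) *\<^sub>C a" by transfer simp
  show "1 *\<^sub>C a = a" by transfer simp
qed

end

lift_definition pure_tensor ::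
    "'a::complex_vector \<Rightarrow> 'b::complex_vector \<Rightarrow> ('a, 'b) tensor" (infixr "\<otimes>\<^sub>C" 70)
  is "\<lambda>x y. Poly_Mapping.single (x, y) 1" .

lemma cbilinear_pure_tensor: "cbilinear (\<otimes>\<^sub>C)"
  unfolding cbilinear_def clinear_iff
  by (intro conjI allI; transfer)
     (unfold tensor_relations_def Let_def, (rule cvs.span_base, blast)+)

text \<open>The linear map on the tensor product that a bilinear map induces.  It is defined through a
  representative, whose choice does not matter when \<^term>\<open>f\<close> is bilinear.\<close>

definition tensor_lift ::
    "('a::complex_vector \<Rightarrow> 'b::complex_vector \<Rightarrow> 'c::complex_vector) \<Rightarrow> ('a, 'b) tensor \<Rightarrow> 'c" where
  "tensor_lift f t = lin_ext (\<lambda>(x, y). f x y) (rep_tensor t)"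

lemma lin_ext_tensor_relations:
  assumes "cbilinear f" "u \<in> tensor_relations"
  shows "lin_ext (\<lambda>(x, y). f x y) u = 0"
proof -
  interpret L: Vector_Spaces.linear scaleC scaleC "lin_ext (\<lambda>(x, y). f x y)"
    by (rule clinear_lin_ext)
  have f: "f (x + x') y = f x y + f x' y" "f x (y + y') = f x y + f x y'"
    "f (c *\<^sub>C x) y = c *\<^sub>C f x y" "f x (c *\<^sub>C y) = c *\<^sub>C f x y" for x x' y y' c
    using assms(1) by (simp_all add: cbilinear_def clinear_iff)
  have "tensor_relations \<subseteq> {u. lin_ext (\<lambda>(x, y). f x y) u = 0}"
    unfolding tensor_relations_def Let_def
    by (rule cvs.span_minimal[OF _ L.subspace_kernel])
       (auto simp only: L.add L.diff L.scale lin_ext_single prod.case f scaleC_one diff_self)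
  with assms(2) show ?thesis by blast
qed

lemma tensor_lift_abs:
  assumes "cbilinear f"
  shows "tensor_lift f (abs_tensor u) = lin_ext (\<lambda>(x, y). f x y) u"
proof -
  interpret L: Vector_Spaces.linear scaleC scaleC "lin_ext (\<lambda>(x, y). f x y)"
    by (rule clinear_lin_ext)
  have "rep_tensor (abs_tensor u) - u \<in> tensor_relations"
    by (rule Quotient3_rep_abs[OF Quotient3_tensor]) (simp add: cvs.subspace_0 subspace_tensor_relations)
  from lin_ext_tensor_relations[OF assms this] show ?thesis
    by (simp add: tensor_lift_def L.diff)
qed

lemma tensor_lift_pure [simp]: "cbilinear f \<Longrightarrow> tensor_lift f (x \<otimes>\<^sub>C y) = f x y"
  by (simp add: tensor_lift_abs pure_tensor.abs_eq scaleC_one)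

lemma clinear_tensor_lift:
  assumes "cbilinear f" shows "clinear (tensor_lift f)"
  unfolding clinear_iff
proof (intro conjI allI)
  fix s t :: "('a, 'b) tensor" and c
  obtain u v where "s = abs_tensor u" "t = abs_tensor v"
    using Quotient3_abs_rep[OF Quotient3_tensor] by metis
  then show "tensor_lift f (s + t) = tensor_lift f s + tensor_lift f t"
    and "tensor_lift f (c *\<^sub>C s) = c *\<^sub>C tensor_lift f s"
    by (simp_all add: plus_tensor.abs_eq scaleC_tensor.abs_eq tensor_lift_abs[OF assms]
        lin_ext_add lin_ext_scaleC)
qed

definition tensor_lift2 ::
    "('a::complex_vector \<Rightarrow> 'b::complex_vector \<Rightarrow> 'c::complex_vector \<Rightarrow> 'd::complex_vector
        \<Rightarrow> 'e::complex_vector) \<Rightarrow> ('a, 'b) tensor \<Rightarrow> ('c, 'd) tensor \<Rightarrow> 'e" where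
  "tensor_lift2 f s t = tensor_lift (\<lambda>x y. tensor_lift (f x y) t) s"

lemma cbilinearI:
  assumes "\<And>x x' y. f (x + x') y = f x y + f x' y" "\<And>x y y'. f x (y + y') = f x y + f x y'"
    and "\<And>c x y. f (c *\<^sub>C x) y = c *\<^sub>C f x y" "\<And>c x y. f x (c *\<^sub>C y) = c *\<^sub>C f x y"
  shows "cbilinear f"
  using assms by (simp add: cbilinear_def clinear_iff)

lemma cbilinearD:
  assumes "cbilinear f"
  shows "f (x + x') y = f x y + f x' y" "f x (y + y') = f x y + f x y'"
    "f (c *\<^sub>C x) y = c *\<^sub>C f x y" "f x (c *\<^sub>C y) = c *\<^sub>C f x y"
  using assms by (simp_all add: cbilinear_def clinear_iff)

lemma tensor_lift_fun_add:
  "tensor_lift (\<lambda>x y. f x y + g x y) t = tensor_lift f t + tensor_lift g t"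
  by (simp add: tensor_lift_def lin_ext_def case_prod_unfold scaleC_add_right sum.distrib)

lemma tensor_lift_fun_scaleC:
  "tensor_lift (\<lambda>x y. c *\<^sub>C f x y) t = c *\<^sub>C tensor_lift f t"
  by (simp add: tensor_lift_def lin_ext_def case_prod_unfold cvs.scale_sum_right mult.commute)

lemma tensor_lift_linear:
  assumes "cbilinear f"
  shows "tensor_lift f (s + t) = tensor_lift f s + tensor_lift f t"
    "tensor_lift f (c *\<^sub>C s) = c *\<^sub>C tensor_lift f s"
  using clinear_tensor_lift[OF assms] by (simp_all add: clinear_iff)

context
  fixes f :: "'a::complex_vector \<Rightarrow> 'b::complex_vector \<Rightarrow> 'c::complex_vector \<Rightarrow> 'd::complex_vector
    \<Rightarrow> 'e::complex_vector"
  assumes f1: "\<And>x y. cbilinear (f x y)" and f2: "\<And>z w. cbilinear (\<lambda>x y. f x y z w)"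
begin

lemma cbilinear_inner_lift: "cbilinear (\<lambda>x y. tensor_lift (f x y) t)"
proof -
  have "f (x + x') y = (\<lambda>z w. f x y z w + f x' y z w)"
    "f x (y + y') = (\<lambda>z w. f x y z w + f x y' z w)"
    "f (c *\<^sub>C x) y = (\<lambda>z w. c *\<^sub>C f x y z w)"
    "f x (c *\<^sub>C y) = (\<lambda>z w. c *\<^sub>C f x y z w)" for x x' y y' c
    using cbilinearD[OF f2] by (auto simp: fun_eq_iff)
  then show ?thesis
    by (intro cbilinearI) (simp_all add: tensor_lift_fun_add tensor_lift_fun_scaleC)
qed

lemma cbilinear_tensor_lift2: "cbilinear (tensor_lift2 f)"
  unfolding tensor_lift2_def
  by (intro cbilinearI)
     (simp_all add: tensor_lift_linear[OF f1] tensor_lift_fun_add tensor_lift_fun_scaleC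
        tensor_lift_linear[OF cbilinear_inner_lift])

lemma tensor_lift2_pure: "tensor_lift2 f (x \<otimes>\<^sub>C y) (z \<otimes>\<^sub>C w) = f x y z w"
  by (simp add: tensor_lift2_def tensor_lift_pure[OF cbilinear_inner_lift]
      tensor_lift_pure[OF f1] tensor_lift_pure[OF f2])

end

section \<open>Toroidal Lie algebras with coefficients\<close>

subsection \<open>Laurent polynomials and the space \<open>Z = \<Omega>\<^sub>A / dA\<close>\<close>

text \<open>The indices \<open>0, \<dots>, n\<close> are the elements of \<^typ>\<open>'n option\<close>, with \<^term>\<open>None\<close> as the index \<open>0\<close>
  and \<open>n = CARD('n) \<ge> 1\<close>.  The exponent \<open>(k\<^sub>0, \<dots>, k\<^sub>n)\<close> is a vector in \<^typ>\<open>int ^ ('n option)\<close>, and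
  the Laurent polynomial ring \<open>A\<close> is the group algebra of the exponent group, with the convolution
  product of \<^theory>\<open>HOL-Library.Poly_Mapping\<close>.\<close>

type_synonym 'n expo = "int ^ ('n option)"
type_synonym 'n laurent = "'n expo \<Rightarrow>\<^sub>0 complex"

abbreviation t_mono :: "'n::finite expo \<Rightarrow> 'n laurent" where
  "t_mono k \<equiv> Poly_Mapping.single k 1"

text \<open>The basis vector of \<open>\<Omega>\<^sub>A\<close> indexed by \<^term>\<open>(k, i)\<close> is \<open>t\<^sup>k K\<^sub>i\<close>.\<close>

type_synonym 'n omega = "('n expo \<times> 'n option) \<Rightarrow>\<^sub>0 complex"

definition dA :: "'n::finite omega set" where
  "dA = cvs.span (range (\<lambda>k. \<Sum>i\<in>UNIV. of_int (k $ i) *\<^sub>C Poly_Mapping.single (k, i) 1))"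

lemma subspace_dA: "cvs.subspace dA"
  by (simp add: dA_def)

quotient_type (overloaded) 'n zspace = "'n::finite omega" / "\<lambda>u v. u - v \<in> dA"
  by (rule equivp_subspace) (rule subspace_dA)

instantiation zspace :: (finite) complex_vector
begin

lift_definition zero_zspace :: "'a zspace" is 0 .

lift_definition plus_zspace :: "'a zspace \<Rightarrow> 'a zspace \<Rightarrow> 'a zspace" is "(+)"
proof -
  fix u v u' v' :: "'a omega"
  assume "u - v \<in> dA" "u' - v' \<in> dA"
  then have "(u - v) + (u' - v') \<in> dA"
    by (rule cvs.subspace_add[OF subspace_dA])
  then show "(u + u') - (v + v') \<in> dA"
    by (simp add: algebra_simps)
qed

lift_definition uminus_zspace :: "'a zspace \<Rightarrow> 'a zspace" is "uminus"
proof -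
  fix u v :: "'a omega"
  assume "u - v \<in> dA"
  then have "- (u - v) \<in> dA"
    by (rule cvs.subspace_neg[OF subspace_dA])
  then show "- u - - v \<in> dA" by simp
qed

lift_definition minus_zspace :: "'a zspace \<Rightarrow> 'a zspace \<Rightarrow> 'a zspace" is "(-)"
proof -
  fix u v u' v' :: "'a omega"
  assume "u - v \<in> dA" "u' - v' \<in> dA"
  then have "(u - v) - (u' - v') \<in> dA"
    by (rule cvs.subspace_diff[OF subspace_dA])
  then show "(u - u') - (v - v') \<in> dA"
    by (simp add: algebra_simps)
qed

lift_definition scaleC_zspace :: "complex \<Rightarrow> 'a zspace \<Rightarrow> 'a zspace" is "scaleC"
proof -
  fix c and u v :: "'a omega"
  assume "u - v \<in> dA"
  then have "c *\<^sub>C (u - v) \<in> dA"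
    by (rule cvs.subspace_scale[OF subspace_dA])
  then show "c *\<^sub>C u - c *\<^sub>C v \<in> dA"
    by (simp only: cvs.scale_right_diff_distrib)
qed

instance
proof
  note subspace_dA [THEN cvs.subspace_0, simp]
  fix a b c :: "'a zspace" and k l :: complex
  show "a + b + c = a + (b + c)" by transfer (simp add: add.assoc)
  show "a + b = b + a" by transfer (simp add: add.commute)
  show "0 + a = a" by transfer simp
  show "- a + a = 0" by transfer simp
  show "a - b = a + - b" by transfer simp
  show "k *\<^sub>C (a + b) = k *\<^sub>C a + k *\<^sub>C b" by transfer (simp add: scaleC_add_right)
  show "(k + l) *\<^sub>C a = k *\<^sub>C a + l *\<^sub>C a" by transfer (simp add: scaleC_add_left)
  show "k *\<^sub>C l *\<^sub>C a = (k * l) *\<^sub>C a" by transfer simp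
  show "1 *\<^sub>C a = a" by transfer simp
qed

end

text \<open>The class of \<open>t\<^sup>k K\<^sub>i\<close> in \<open>Z\<close>.\<close>

lift_definition tK :: "'n::finite expo \<Rightarrow> 'n option \<Rightarrow> 'n zspace" is
  "\<lambda>k i. Poly_Mapping.single (k, i) 1" .

text \<open>The eigenvalue of \<open>\<Sum>\<^sub>i c\<^sub>i d\<^sub>i\<close> on vectors of degree \<^term>\<open>k\<close>.\<close>

definition degree_val :: "complex ^ ('n::finite option) \<Rightarrow> 'n expo \<Rightarrow> complex" where
  "degree_val c k = (\<Sum>i\<in>UNIV. c $ i * of_int (k $ i))"

definition laurent_deriv :: "complex ^ ('n::finite option) \<Rightarrow> 'n laurent \<Rightarrow> 'n laurent" where
  "laurent_deriv c = lin_ext (\<lambda>k. degree_val c k *\<^sub>C t_mono k)"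

definition omega_deriv :: "complex ^ ('n::finite option) \<Rightarrow> 'n omega \<Rightarrow> 'n omega" where
  "omega_deriv c = lin_ext (\<lambda>(k, i). degree_val c k *\<^sub>C Poly_Mapping.single (k, i) 1)"

lemma omega_deriv_dA:
  assumes "u \<in> dA" shows "omega_deriv c u \<in> dA"
proof -
  interpret L: Vector_Spaces.linear scaleC scaleC "omega_deriv c"
    unfolding omega_deriv_def by (rule clinear_lin_ext)
  have "omega_deriv c (\<Sum>i\<in>UNIV. of_int (k $ i) *\<^sub>C Poly_Mapping.single (k, i) 1)
      = degree_val c k *\<^sub>C (\<Sum>i\<in>UNIV. of_int (k $ i) *\<^sub>C Poly_Mapping.single (k, i) 1)" for k
    unfolding L.sum L.scale
    by (simp add: omega_deriv_def scaleC_one cvs.scale_sum_right mult.commute)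
  then have "range (\<lambda>k. \<Sum>i\<in>UNIV. of_int (k $ i) *\<^sub>C Poly_Mapping.single (k, i) 1)
      \<subseteq> omega_deriv c -` dA"
    unfolding dA_def by (auto intro: cvs.span_scale cvs.span_base)
  then have "dA \<subseteq> omega_deriv c -` dA"
    using cvs.span_minimal[OF _ L.subspace_vimage[OF subspace_dA]] by (simp add: dA_def)
  with assms show ?thesis by blast
qed

lift_definition zspace_deriv :: "complex ^ ('n::finite option) \<Rightarrow> 'n zspace \<Rightarrow> 'n zspace" is omega_deriv
proof -
  fix c :: "complex ^ ('n option)" and u v :: "'n omega"
  interpret L: Vector_Spaces.linear scaleC scaleC "omega_deriv c"
    unfolding omega_deriv_def by (rule clinear_lin_ext)
  assume "u - v \<in> dA"
  from omega_deriv_dA[OF this, of c] show "omega_deriv c u - omega_deriv c v \<in> dA"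
    by (simp add: L.diff)
qed

text \<open>The bilinear map sending \<open>(t\<^sup>k, t\<^sup>r)\<close> to the class of \<open>\<Sum>\<^sub>i k\<^sub>i t\<^sup>k\<^sup>+\<^sup>r K\<^sub>i\<close>.\<close>

definition cocycle :: "'n::finite laurent \<Rightarrow> 'n laurent \<Rightarrow> 'n zspace" where
  "cocycle a a' = lin_ext (\<lambda>k. lin_ext (\<lambda>r. \<Sum>i\<in>UNIV. of_int (k $ i) *\<^sub>C tK (k + r) i) a') a"

subsection \<open>The brackets\<close>

type_synonym ('g, 'n) tau0 = "('g, 'n laurent) tensor \<times> 'n zspace"
type_synonym ('g, 'n, 'b) tau = "(('g, 'n) tau0, 'b) tensor \<times> (complex ^ ('n option))"

definition tau0_bracket :: "('g \<Rightarrow> 'g \<Rightarrow> complex) \<Rightarrow>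
    ('g::complex_lie_algebra, 'n::finite) tau0 \<Rightarrow> ('g, 'n) tau0 \<Rightarrow> ('g, 'n) tau0" where
  "tau0_bracket form X Y =
    (tensor_lift2 (\<lambda>x a y a'. lie x y \<otimes>\<^sub>C (a * a')) (fst X) (fst Y),
     tensor_lift2 (\<lambda>x a y a'. form x y *\<^sub>C cocycle a a') (fst X) (fst Y))"

definition tau0_deriv :: "complex ^ ('n option) \<Rightarrow>
    ('g::complex_lie_algebra, 'n::finite) tau0 \<Rightarrow> ('g, 'n) tau0" where
  "tau0_deriv c X = (tensor_lift (\<lambda>x a. x \<otimes>\<^sub>C laurent_deriv c a) (fst X), zspace_deriv c (snd X))"

definition tau_deriv :: "complex ^ ('n option) \<Rightarrow>
    (('g::complex_lie_algebra, 'n::finite) tau0, 'b::complex_comm_algebra) tensor \<Rightarrow>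
    (('g, 'n) tau0, 'b) tensor" where
  "tau_deriv c = tensor_lift (\<lambda>X b. tau0_deriv c X \<otimes>\<^sub>C b)"

text \<open>An element of \<open>\<tau>(B) = \<tau>\<^sub>0 \<otimes> B \<oplus> D\<close> is a pair whose second component lists the
  coefficients of \<open>d\<^sub>0, \<dots>, d\<^sub>n\<close>.\<close>

definition tau_bracket :: "('g \<Rightarrow> 'g \<Rightarrow> complex) \<Rightarrow>
    ('g::complex_lie_algebra, 'n::finite, 'b::complex_comm_algebra) tau \<Rightarrow>
    ('g, 'n, 'b) tau \<Rightarrow> ('g, 'n, 'b) tau" where
  "tau_bracket form X Y =
    (tensor_lift2 (\<lambda>S b T b'. tau0_bracket form S T \<otimes>\<^sub>C (b * b')) (fst X) (fst Y)
       + tau_deriv (snd X) (fst Y) - tau_deriv (snd Y) (fst X), 0)"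

definition loop_elt :: "'g \<Rightarrow> 'n laurent \<Rightarrow> 'b \<Rightarrow>
    ('g::complex_lie_algebra, 'n::finite, 'b::complex_comm_algebra) tau" where
  "loop_elt x a b = ((x \<otimes>\<^sub>C a, 0) \<otimes>\<^sub>C b, 0)"

definition z_elt :: "'n zspace \<Rightarrow> 'b \<Rightarrow>
    ('g::complex_lie_algebra, 'n::finite, 'b::complex_comm_algebra) tau" where
  "z_elt z b = ((0, z) \<otimes>\<^sub>C b, 0)"

definition K_elt :: "'n option \<Rightarrow>
    ('g::complex_lie_algebra, 'n::finite, 'b::complex_comm_algebra) tau" where
  "K_elt i = z_elt (tK 0 i) 1"

definition d_elt :: "'n option \<Rightarrow>
    ('g::complex_lie_algebra, 'n::finite, 'b::complex_comm_algebra) tau" where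
  "d_elt i = (0, axis i 1)"

lemma mult_scaleC_right: "x * (c *\<^sub>C y) = c *\<^sub>C (x * y)" for x y :: "'b::complex_comm_algebra"
  by (metis mult.commute scaleC_mult_left)

lemma scaleC_laurent_mult:
  fixes a a' :: "'n::finite laurent"
  shows "(c *\<^sub>C a) * a' = c *\<^sub>C (a * a')" "a * (c *\<^sub>C a') = c *\<^sub>C (a * a')"
proof -
  have single: "c *\<^sub>C a = Poly_Mapping.single 0 c * a" for a :: "'n laurent"
    by (rule poly_mapping_eqI)
       (simp add: lookup_mult lookup_single when_mult Sum_any_right_distrib[symmetric] scaleC_complex_def)
  show "(c *\<^sub>C a) * a' = c *\<^sub>C (a * a')" "a * (c *\<^sub>C a') = c *\<^sub>C (a * a')"
    by (simp_all add: single mult.assoc mult.left_commute)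
qed

lemma lin_ext_fun:
  "lin_ext (\<lambda>k. f k + g k) a = lin_ext f a + lin_ext g a"
  "lin_ext (\<lambda>k. c *\<^sub>C f k) a = c *\<^sub>C lin_ext f a"
  by (simp_all add: lin_ext_def scaleC_add_right sum.distrib cvs.scale_sum_right mult.commute)

lemma cbilinear_cocycle: "cbilinear cocycle"
  unfolding cocycle_def
  by (rule cbilinearI) (simp_all add: lin_ext_add lin_ext_scaleC lin_ext_fun)

lemma cocycle_monomials:
  "cocycle (t_mono k) (t_mono r) = (\<Sum>i\<in>UNIV. of_int (k $ i) *\<^sub>C tK (k + r) i)"
  by (simp add: cocycle_def scaleC_one)

lemma tau0_bracket_pure:
  assumes "cbilinear form"
  shows "tau0_bracket form (x \<otimes>\<^sub>C a, z) (y \<otimes>\<^sub>C a', z')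
    = (lie x y \<otimes>\<^sub>C (a * a'), form x y *\<^sub>C cocycle a a')"
proof -
  note bil = cbilinearD[OF cbilinear_pure_tensor] cbilinearD[OF cbilinear_cocycle]
    cbilinearD[OF assms] lie_add_left lie_add_right lie_scaleC_left lie_scaleC_right
    scaleC_laurent_mult distrib_left distrib_right
  show ?thesis
    unfolding tau0_bracket_def fst_conv
    by (subst (1 2) tensor_lift2_pure)
       (auto intro!: cbilinearI simp: bil scaleC_add_left scaleC_add_right scaleC_complex_def
          mult.commute mult.left_commute)
qed

lemma t_mono_mult: "t_mono k * t_mono r = t_mono (k + r)"
  by (simp add: mult_single)

lemma poly_mapping_expansion:
  fixes u :: "'i \<Rightarrow>\<^sub>0 complex"
  shows "u = (\<Sum>k\<in>Poly_Mapping.keys u. Poly_Mapping.lookup u k *\<^sub>C Poly_Mapping.single k 1)"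
  by (rule poly_mapping_eqI)
     (simp add: lookup_sum lookup_single scaleC_complex_def when_def if_distrib[of "(*) _"]
       sum.delta in_keys_iff cong: if_cong)

lemma abs_tensor_lin_ext: "abs_tensor u = lin_ext (\<lambda>(x, y). x \<otimes>\<^sub>C y) u"
proof -
  have "abs_tensor (\<Sum>k\<in>K. f k *\<^sub>C Poly_Mapping.single k 1) = (\<Sum>k\<in>K. f k *\<^sub>C (fst k \<otimes>\<^sub>C snd k))"
    if "finite K" for K f
    using that
    by induction (auto simp: zero_tensor.abs_eq plus_tensor.abs_eq[symmetric]
        scaleC_tensor.abs_eq[symmetric] pure_tensor.abs_eq)
  from this[of "Poly_Mapping.keys u" "Poly_Mapping.lookup u"] show ?thesis
    by (subst poly_mapping_expansion) (simp add: lin_ext_def case_prod_unfold)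
qed

lemma pure_tensor_0: "0 \<otimes>\<^sub>C y = 0" "x \<otimes>\<^sub>C 0 = 0"
  using cbilinearD(3)[OF cbilinear_pure_tensor, of 0 0 y]
    cbilinearD(4)[OF cbilinear_pure_tensor, of x 0 0] by simp_all

lemma pure_tensor_minus: "(- x) \<otimes>\<^sub>C y = - (x \<otimes>\<^sub>C y)"
  using cbilinearD(3)[OF cbilinear_pure_tensor, of "-1" x y] by simp

lemma tensor_induct [case_names pure add]:
  assumes pure: "\<And>x y. P (x \<otimes>\<^sub>C y)" and add: "\<And>s t. P s \<Longrightarrow> P t \<Longrightarrow> P (s + t)"
  shows "P t"
proof -
  have 0: "P 0"
    using pure[of 0 0] by (simp add: pure_tensor_0)
  have "P (\<Sum>k\<in>K. f k *\<^sub>C (fst k \<otimes>\<^sub>C snd k))" if "finite K" for K f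
    using that
  proof induction
    case (insert k K)
    have "P (f k *\<^sub>C (fst k \<otimes>\<^sub>C snd k))"
      using pure[of "f k *\<^sub>C fst k" "snd k"] by (simp add: cbilinearD[OF cbilinear_pure_tensor])
    with insert show ?case by (simp add: add)
  qed (simp add: 0)
  moreover obtain u where "t = abs_tensor u"
    using Quotient3_abs_rep[OF Quotient3_tensor] by metis
  ultimately show ?thesis
    by (simp add: abs_tensor_lin_ext lin_ext_def case_prod_unfold)
qed

lemma laurent_tensor_induct [case_names mono add]:
  fixes t :: "('g::complex_vector, 'n::finite laurent) tensor"
  assumes mono: "\<And>x k. P (x \<otimes>\<^sub>C t_mono k)" and add: "\<And>s t. P s \<Longrightarrow> P t \<Longrightarrow> P (s + t)"
  shows "P t"
proof (induction t rule: tensor_induct)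
  case (pure x a)
  have 0: "P 0"
    using mono[of 0 0] by (simp add: pure_tensor_0)
  have "P (x \<otimes>\<^sub>C (\<Sum>k\<in>K. f k *\<^sub>C t_mono k))" if "finite K" for K and f :: "'n expo \<Rightarrow> complex"
    using that
  proof induction
    case empty
    then show ?case
      using 0 by (simp add: pure_tensor_0)
  next
    case (insert k K)
    have "P (x \<otimes>\<^sub>C (f k *\<^sub>C t_mono k))"
      using mono[of "f k *\<^sub>C x" k] by (simp add: cbilinearD[OF cbilinear_pure_tensor])
    with insert show ?case by (simp add: add cbilinearD[OF cbilinear_pure_tensor])
  qed
  then show ?case by (subst poly_mapping_expansion) simp
qed (rule add)

lemma clinearD:
  assumes "clinear f"
  shows "f (x + y) = f x + f y" "f (c *\<^sub>C x) = c *\<^sub>C f x" "f 0 = 0" "f (x - y) = f x - f y"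
    "f (- x) = - f x"
proof -
  interpret Vector_Spaces.linear scaleC scaleC f by (rule assms)
  show "f (x + y) = f x + f y" "f (c *\<^sub>C x) = c *\<^sub>C f x" "f 0 = 0" "f (x - y) = f x - f y"
    "f (- x) = - f x"
    by (simp_all add: add scale diff neg)
qed

lemma clinear_laurent_deriv: "clinear (laurent_deriv c)"
  unfolding laurent_deriv_def by (rule clinear_lin_ext)

lemma laurent_deriv_mono: "laurent_deriv c (t_mono k) = degree_val c k *\<^sub>C t_mono k"
  by (simp add: laurent_deriv_def scaleC_one)

lemma clinear_zspace_deriv: "clinear (zspace_deriv c)"
proof -
  have "clinear (omega_deriv c)"
    unfolding omega_deriv_def by (rule clinear_lin_ext)
  then show ?thesis
    unfolding clinear_iff by (intro conjI allI; transfer) (simp_all add: cvs.subspace_0 subspace_dA)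
qed

lemma zspace_deriv_tK: "zspace_deriv c (tK k i) = degree_val c k *\<^sub>C tK k i"
  by transfer (simp add: omega_deriv_def scaleC_one cvs.subspace_0 subspace_dA)

lemma clinear_tau0_deriv:
  fixes c :: "complex ^ ('n::finite option)"
  shows "clinear (tau0_deriv c :: ('g::complex_lie_algebra, 'n) tau0 \<Rightarrow> _)"
proof -
  have "cbilinear (\<lambda>(x :: 'g) a. x \<otimes>\<^sub>C laurent_deriv c a)"
    by (intro cbilinearI)
       (simp_all add: cbilinearD[OF cbilinear_pure_tensor] clinearD[OF clinear_laurent_deriv])
  from tensor_lift_linear[OF this] show ?thesis
    by (simp add: clinear_iff tau0_deriv_def scaleC_prod_def
        clinearD[OF clinear_zspace_deriv])
qed

lemma tau0_deriv_pure: "tau0_deriv c (x \<otimes>\<^sub>C a, z) = (x \<otimes>\<^sub>C laurent_deriv c a, zspace_deriv c z)"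
  unfolding tau0_deriv_def
  by (subst fst_conv, subst tensor_lift_pure)
     (auto intro!: cbilinearI
       simp: cbilinearD[OF cbilinear_pure_tensor] clinearD[OF clinear_laurent_deriv])

lemma clinear_tau_deriv: "clinear (tau_deriv c)"
  and tau_deriv_pure: "tau_deriv c (X \<otimes>\<^sub>C b) = tau0_deriv c X \<otimes>\<^sub>C b"
proof -
  have *: "cbilinear (\<lambda>X b. tau0_deriv c X \<otimes>\<^sub>C b)"
    by (intro cbilinearI)
       (simp_all add: cbilinearD[OF cbilinear_pure_tensor] clinearD[OF clinear_tau0_deriv])
  show "clinear (tau_deriv c)" "tau_deriv c (X \<otimes>\<^sub>C b) = tau0_deriv c X \<otimes>\<^sub>C b"
    unfolding tau_deriv_def by (rule clinear_tensor_lift[OF *], rule tensor_lift_pure[OF *])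
qed

definition Z_tensor_B ::
    "('g::complex_lie_algebra, 'n::finite, 'b::complex_comm_algebra) tau set" where
  "Z_tensor_B = cvs.span {z_elt z b | z b. True}"

section \<open>Cartan subalgebras, roots and the normalized form\<close>

definition lie_ideal :: "'g::complex_lie_algebra set \<Rightarrow> bool" where
  "lie_ideal I \<longleftrightarrow> cvs.subspace I \<and> (\<forall>x. \<forall>y\<in>I. lie x y \<in> I)"

definition simple_lie_algebra :: "'g::complex_lie_algebra itself \<Rightarrow> bool" where
  "simple_lie_algebra _ \<longleftrightarrow>
     (\<exists>x y :: 'g. lie x y \<noteq> 0) \<and> (\<forall>I :: 'g set. lie_ideal I \<longrightarrow> I = {0} \<or> I = UNIV)"

text \<open>The usual definition for a semisimple algebra over the complex numbers: a maximal abelian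
  subalgebra whose elements are ad-diagonalizable.\<close>

definition cartan_subalgebra :: "'g::complex_lie_algebra set \<Rightarrow> bool" where
  "cartan_subalgebra h \<longleftrightarrow> cvs.subspace h
     \<and> (\<forall>x\<in>h. \<forall>y\<in>h. lie x y = 0)
     \<and> (\<forall>x. (\<forall>y\<in>h. lie y x = 0) \<longrightarrow> x \<in> h)
     \<and> (\<forall>y\<in>h. cvs.span {x. \<exists>c. lie y x = c *\<^sub>C x} = UNIV)"

text \<open>The linear functionals on a subspace, as functions that are \<^term>\<open>undefined\<close> outside it.\<close>

definition cdual :: "'a::complex_vector set \<Rightarrow> ('a \<Rightarrow> complex) set" where
  "cdual W = {f \<in> extensional W.
     (\<forall>x\<in>W. \<forall>y\<in>W. f (x + y) = f x + f y) \<and> (\<forall>c. \<forall>x\<in>W. f (c *\<^sub>C x) = c * f x)}"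

definition root_space :: "'g::complex_lie_algebra set \<Rightarrow> ('g \<Rightarrow> complex) \<Rightarrow> 'g set" where
  "root_space h \<alpha> = {x. \<forall>y\<in>h. lie y x = \<alpha> y *\<^sub>C x}"

definition roots :: "'g::complex_lie_algebra set \<Rightarrow> ('g \<Rightarrow> complex) set" where
  "roots h = {\<alpha> \<in> cdual h. (\<exists>y\<in>h. \<alpha> y \<noteq> 0) \<and> root_space h \<alpha> \<noteq> {0}}"

definition invariant_form :: "('g::complex_lie_algebra \<Rightarrow> 'g \<Rightarrow> complex) \<Rightarrow> bool" where
  "invariant_form form \<longleftrightarrow> cbilinear form
     \<and> (\<forall>x y. form x y = form y x)
     \<and> (\<forall>x y z. form (lie x y) z = form x (lie y z))
     \<and> (\<forall>x. (\<forall>y. form x y = 0) \<longrightarrow> x = 0)"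

text \<open>The value \<open>(\<alpha>, \<alpha>)\<close> of the form that \<^term>\<open>form\<close> induces on the dual of \<^term>\<open>h\<close>.\<close>

definition root_sqlen :: "'g::complex_lie_algebra set \<Rightarrow> ('g \<Rightarrow> 'g \<Rightarrow> complex) \<Rightarrow>
    ('g \<Rightarrow> complex) \<Rightarrow> complex" where
  "root_sqlen h form \<alpha> = \<alpha> (THE t. t \<in> h \<and> (\<forall>y\<in>h. form t y = \<alpha> y))"

text \<open>The normalization is \<open>(\<theta>, \<theta>) = 2\<close> for the long roots \<open>\<theta>\<close>.\<close>

definition normalized_form :: "'g::complex_lie_algebra set \<Rightarrow> ('g \<Rightarrow> 'g \<Rightarrow> complex) \<Rightarrow> bool" where
  "normalized_form h form \<longleftrightarrow> invariant_form form
     \<and> (\<exists>\<theta>\<in>roots h. root_sqlen h form \<theta> = 2)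
     \<and> (\<forall>\<alpha>\<in>roots h. root_sqlen h form \<alpha> \<in> \<real> \<and> Re (root_sqlen h form \<alpha>) \<le> 2)"

section \<open>The Lie algebra axioms\<close>

lemma tau_induct [case_names tau0 D add]:
  fixes X :: "('g::complex_lie_algebra, 'n::finite, 'b::complex_comm_algebra) tau"
  assumes "\<And>S b. P (S \<otimes>\<^sub>C b, 0)" "\<And>c. P (0, c)" "\<And>X Y. P X \<Longrightarrow> P Y \<Longrightarrow> P (X + Y)"
  shows "P X"
proof -
  have "P (t, 0)" for t
  proof (induction t rule: tensor_induct)
    case (add s t)
    then show ?case using assms(3)[of "(s, 0)" "(t, 0)"] by simp
  qed (rule assms(1))
  then show ?thesis
    using assms(3)[of "(fst X, 0)" "(0, snd X)"] assms(2) by simp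
qed

lemma cbilinear_tau0_bracket:
  fixes form :: "'g::complex_lie_algebra \<Rightarrow> 'g \<Rightarrow> complex"
  assumes "cbilinear form"
  shows "cbilinear (tau0_bracket form :: ('g, 'n::finite) tau0 \<Rightarrow> _)"
proof -
  note bil = cbilinearD[OF cbilinear_pure_tensor] cbilinearD[OF cbilinear_cocycle]
    cbilinearD[OF assms] lie_add_left lie_add_right lie_scaleC_left lie_scaleC_right
    scaleC_laurent_mult distrib_left distrib_right
  have 1: "cbilinear (tensor_lift2 (\<lambda>(x::'g) (a :: 'n laurent) y a'. lie x y \<otimes>\<^sub>C (a * a')))"
    by (rule cbilinear_tensor_lift2) (auto intro!: cbilinearI simp: bil)
  have 2: "cbilinear (tensor_lift2 (\<lambda>x (a :: 'n laurent) y a'. form x y *\<^sub>C cocycle a a'))"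
    by (rule cbilinear_tensor_lift2)
       (auto intro!: cbilinearI simp: bil scaleC_add_left scaleC_add_right scaleC_complex_def
          mult.commute mult.left_commute)
  show ?thesis
    by (rule cbilinearI) (simp_all add: tau0_bracket_def cbilinearD[OF 1] cbilinearD[OF 2] scaleC_prod_def)
qed

context
  fixes form :: "'g::complex_lie_algebra \<Rightarrow> 'g \<Rightarrow> complex"
  assumes form: "cbilinear form"
begin

lemma cbilinear_tau0_tensor:
  "cbilinear (tensor_lift2 (\<lambda>(S :: ('g, 'n::finite) tau0) (b :: 'b::complex_comm_algebra) T b'.
    tau0_bracket form S T \<otimes>\<^sub>C (b * b')))" (is ?A)
  and tau0_tensor_pure: "tensor_lift2 (\<lambda>(S :: ('g, 'n) tau0) (b :: 'b) T b'.
    tau0_bracket form S T \<otimes>\<^sub>C (b * b')) (S' \<otimes>\<^sub>C b1) (T' \<otimes>\<^sub>C b2)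
      = tau0_bracket form S' T' \<otimes>\<^sub>C (b1 * b2)" (is ?B)
proof -
  let ?f = "\<lambda>(S :: ('g, 'n) tau0) (b :: 'b) T b'. tau0_bracket form S T \<otimes>\<^sub>C (b * b')"
  note bil = cbilinearD[OF cbilinear_pure_tensor] cbilinearD[OF cbilinear_tau0_bracket[OF form]]
    scaleC_mult_left mult_scaleC_right distrib_left distrib_right
  have 1: "cbilinear (?f S b)" for S b
    by (rule cbilinearI) (simp_all only: bil)
  have 2: "cbilinear (\<lambda>S b. ?f S b T b')" for T b'
    by (rule cbilinearI) (simp_all only: bil)
  show ?A by (rule cbilinear_tensor_lift2[OF 1 2])
  show ?B by (rule tensor_lift2_pure[OF 1 2])
qed

lemma cbilinear_tau0_deriv:
  "cbilinear (tau0_deriv :: _ \<Rightarrow> ('g, 'n::finite) tau0 \<Rightarrow> ('g, 'n) tau0)"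
proof -
  have deg: "degree_val (c + c') k = degree_val c k + degree_val c' k"
    "degree_val (l *\<^sub>C c) k = l * degree_val c k" for c c' l and k :: "'n expo"
    by (simp_all add: degree_val_def scaleC_vec_def scaleC_complex_def sum.distrib
        sum_distrib_left algebra_simps)
  have 1: "laurent_deriv (c + c') a = laurent_deriv c a + laurent_deriv c' a"
    "laurent_deriv (l *\<^sub>C c) a = l *\<^sub>C laurent_deriv c a" for c c' l and a :: "'n laurent"
    by (simp_all add: laurent_deriv_def deg scaleC_add_left lin_ext_fun
        flip: scaleC_scaleC)
  have "omega_deriv (c + c') a = omega_deriv c a + omega_deriv c' a"
    "omega_deriv (l *\<^sub>C c) a = l *\<^sub>C omega_deriv c a" for c c' l and a :: "'n omega"
    by (simp_all add: omega_deriv_def deg scaleC_add_left lin_ext_fun case_prod_unfold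
        flip: scaleC_scaleC)
  then have 2: "zspace_deriv (c + c') z = zspace_deriv c z + zspace_deriv c' z"
    "zspace_deriv (l *\<^sub>C c) z = l *\<^sub>C zspace_deriv c z" for c c' l and z :: "'n zspace"
    by (transfer, simp add: cvs.subspace_0 subspace_dA)+
  show ?thesis
    by (rule cbilinearI)
       (simp_all add: clinearD[OF clinear_tau0_deriv],
        simp_all add: tau0_deriv_def 1 2 scaleC_prod_def cbilinearD[OF cbilinear_pure_tensor]
          tensor_lift_fun_add tensor_lift_fun_scaleC)
qed

lemma cbilinear_tau_deriv:
  "cbilinear (tau_deriv :: _ \<Rightarrow> (('g, 'n::finite) tau0, 'b::complex_comm_algebra) tensor \<Rightarrow> _)"
  by (rule cbilinearI)
     (simp_all add: clinearD[OF clinear_tau_deriv],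
      simp_all add: tau_deriv_def cbilinearD[OF cbilinear_tau0_deriv]
        cbilinearD[OF cbilinear_pure_tensor] tensor_lift_fun_add tensor_lift_fun_scaleC)

lemma cbilinear_tau_bracket:
  "cbilinear (tau_bracket form :: ('g, 'n::finite, 'b::complex_comm_algebra) tau \<Rightarrow> _)"
  by (rule cbilinearI)
     (simp_all add: tau_bracket_def scaleC_prod_def cbilinearD[OF cbilinear_tau0_tensor]
        cbilinearD[OF cbilinear_tau_deriv] cvs.scale_right_diff_distrib scaleC_add_right)

lemma tau_bracket_generators:
  fixes S T :: "('g, 'n::finite) tau0" and b b' :: "'b::complex_comm_algebra"
  shows "tau_bracket form (S \<otimes>\<^sub>C b, 0) (T \<otimes>\<^sub>C b', 0) = (tau0_bracket form S T \<otimes>\<^sub>C (b * b'), 0)"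
  "tau_bracket form (0, c) (S \<otimes>\<^sub>C b, 0) = (tau0_deriv c S \<otimes>\<^sub>C b, 0)"
  "tau_bracket form (S \<otimes>\<^sub>C b, 0) (0, c) = ((- tau0_deriv c S) \<otimes>\<^sub>C b, 0)"
  "tau_bracket form (0, c) (0, c') = (0 :: ('g, 'n, 'b) tau)"
proof -
  have "tau_deriv 0 t = 0" "tau_deriv c (0 :: (('g, 'n) tau0, 'b) tensor) = 0"
    for c and t :: "(('g, 'n) tau0, 'b) tensor"
    using cbilinearD(3)[OF cbilinear_tau_deriv, of 0 0 t]
      cbilinearD(4)[OF cbilinear_tau_deriv, of c 0 0] by simp_all
  moreover have tau0_deriv_0: "tau0_deriv 0 S = 0" for S :: "('g, 'n) tau0"
    using cbilinearD(3)[OF cbilinear_tau0_deriv, of 0 0 S] by simp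
  moreover have "tensor_lift2 (\<lambda>S b T b'. tau0_bracket form S T \<otimes>\<^sub>C (b * b')) s 0 = 0"
    "tensor_lift2 (\<lambda>S b T b'. tau0_bracket form S T \<otimes>\<^sub>C (b * b')) 0 s = 0"
    for s :: "(('g, 'n) tau0, 'b) tensor"
    using cbilinearD(3)[OF cbilinear_tau0_tensor, of 0 0 s]
      cbilinearD(4)[OF cbilinear_tau0_tensor, of s 0 0] by simp_all
  ultimately show
    "tau_bracket form (S \<otimes>\<^sub>C b, 0) (T \<otimes>\<^sub>C b', 0) = (tau0_bracket form S T \<otimes>\<^sub>C (b * b'), 0)"
    "tau_bracket form (0, c) (S \<otimes>\<^sub>C b, 0) = (tau0_deriv c S \<otimes>\<^sub>C b, 0)"
    "tau_bracket form (S \<otimes>\<^sub>C b, 0) (0, c) = ((- tau0_deriv c S) \<otimes>\<^sub>C b, 0)"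
    "tau_bracket form (0, c) (0, c') = (0 :: ('g, 'n, 'b) tau)"
    by (simp_all add: tau_bracket_def tau0_tensor_pure tau_deriv_pure zero_prod_def[symmetric]
        pure_tensor_0 pure_tensor_minus tau0_deriv_0)
qed

end

context
  fixes form :: "'g::complex_lie_algebra \<Rightarrow> 'g \<Rightarrow> complex"
  assumes inv: "invariant_form form"
begin

lemma bilinear_form: "cbilinear form"
  and form_sym: "form x y = form y x"
  and form_inv: "form (lie x y) z = form x (lie y z)"
  using inv by (auto simp: invariant_form_def)

lemma lie_antisym: "lie x y = - lie y x" for x y :: 'g
proof -
  have "(lie x x + lie y x) + (lie x y + lie y y) = 0"
    using lie_self[of "x + y"] unfolding lie_add_left lie_add_right by (simp add: ac_simps)
  then show ?thesis
    by (simp add: lie_self eq_neg_iff_add_eq_0 add.commute)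
qed

lemma lie_jacobi': "lie x (lie y z) = lie (lie x y) z + lie y (lie x z)" for x y z :: 'g
proof -
  have "lie x (lie y z) = - (lie y (lie z x)) - lie z (lie x y)"
    using lie_jacobi[of x y z] by (simp add: eq_neg_iff_add_eq_0 algebra_simps)
  moreover have "lie y (lie z x) = - lie y (lie x z)"
    using lie_scaleC_right[of y "-1" "lie x z"] lie_antisym[of z x]
    by (metis cvs.scale_minus_left scaleC_one)
  ultimately show ?thesis
    using lie_antisym[of z "lie x y"] by simp
qed

lemma tau0_bracket_add:
  "tau0_bracket form (s + s', 0) Y = tau0_bracket form (s, 0) Y + tau0_bracket form (s', 0) Y"
  "tau0_bracket form Y (s + s', 0) = tau0_bracket form Y (s, 0) + tau0_bracket form Y (s', 0)"
  using cbilinearD(1)[OF cbilinear_tau0_bracket[OF bilinear_form], of "(s, 0)" "(s', 0)" Y]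
    cbilinearD(2)[OF cbilinear_tau0_bracket[OF bilinear_form], of Y "(s, 0)" "(s', 0)"]
  by simp_all

lemmas tau0_bracket_linear = cbilinearD[OF cbilinear_tau0_bracket[OF bilinear_form]]

lemma tau0_bracket_mono:
  "tau0_bracket form (x \<otimes>\<^sub>C t_mono k, z) (y \<otimes>\<^sub>C t_mono r, z')
    = (lie x y \<otimes>\<^sub>C t_mono (k + r), form x y *\<^sub>C (\<Sum>i\<in>UNIV. of_int (k $ i) *\<^sub>C tK (k + r) i))"
  by (simp add: tau0_bracket_pure[OF bilinear_form] t_mono_mult cocycle_monomials)

lemma tK_relation: "(\<Sum>i\<in>UNIV. of_int (k $ i) *\<^sub>C tK k i) = 0"
proof -
  have "abs_zspace (\<Sum>i\<in>I. f i *\<^sub>C Poly_Mapping.single (k, i) 1) = (\<Sum>i\<in>I. f i *\<^sub>C tK k i)"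
    for I f
    using finite[of I]
    by induction (auto simp: zero_zspace.abs_eq plus_zspace.abs_eq[symmetric]
        scaleC_zspace.abs_eq[symmetric] tK.abs_eq)
  moreover have "abs_zspace (\<Sum>i\<in>UNIV. of_int (k $ i) *\<^sub>C Poly_Mapping.single (k, i) 1) = 0"
    unfolding zero_zspace.abs_eq zspace.abs_eq_iff
    by (auto simp: dA_def intro: cvs.span_base)
  ultimately show ?thesis by simp
qed

lemma tau0_bracket_antisym:
  fixes X Y :: "('g, 'n::finite) tau0"
  shows "tau0_bracket form X Y = - tau0_bracket form Y X"
proof -
  have "tau0_bracket form (s, 0) (t, 0) = - tau0_bracket form (t, 0) (s, 0)"
    for s t :: "('g, 'n laurent) tensor"
  proof (induction s rule: laurent_tensor_induct)
    case (mono x k)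
    show ?case
    proof (induction t rule: laurent_tensor_induct)
      case (mono y r)
      have "(\<Sum>i\<in>UNIV. of_int (k $ i) *\<^sub>C tK (k + r) i) + (\<Sum>i\<in>UNIV. of_int (r $ i) *\<^sub>C tK (k + r) i) = 0"
        using tK_relation[of "k + r"] by (simp add: scaleC_add_left sum.distrib)
      then have C: "(\<Sum>i\<in>UNIV. of_int (k $ i) *\<^sub>C tK (k + r) i)
          = - (\<Sum>i\<in>UNIV. of_int (r $ i) *\<^sub>C tK (k + r) i)"
        by (simp add: eq_neg_iff_add_eq_0)
      show ?case
        by (simp add: C pure_tensor_minus tau0_bracket_mono add.commute[of r k] form_sym[of y x] lie_antisym[of y x])
    qed (simp add: tau0_bracket_add)
  qed (simp add: tau0_bracket_add)
  from this[of "fst X" "fst Y"] show ?thesis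
    by (simp add: tau0_bracket_def)
qed

lemma tau0_bracket_jacobi:
  fixes X Y Z :: "('g, 'n::finite) tau0"
  shows "tau0_bracket form X (tau0_bracket form Y Z)
    = tau0_bracket form (tau0_bracket form X Y) Z + tau0_bracket form Y (tau0_bracket form X Z)"
proof -
  have "tau0_bracket form (s, 0) (tau0_bracket form (t, 0) (u, 0))
    = tau0_bracket form (tau0_bracket form (s, 0) (t, 0)) (u, 0)
      + tau0_bracket form (t, 0) (tau0_bracket form (s, 0) (u, 0))"
    for s t u :: "('g, 'n laurent) tensor"
  proof (induction s rule: laurent_tensor_induct)
    case (mono x k)
    show ?case
    proof (induction t rule: laurent_tensor_induct)
      case (mono y r)
      show ?case
      proof (induction u rule: laurent_tensor_induct)
        case (mono z l)
        have f1: "form (lie x y) z = form x (lie y z)"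
          by (rule form_inv)
        have "form y (lie x z) = form (- lie x y) z"
          by (simp only: form_inv[of y x z, symmetric] lie_antisym[of y x])
        also have "\<dots> = - form x (lie y z)"
          using cbilinearD(3)[OF bilinear_form, of "-1" "lie x y" z] by (simp only: f1)
            (simp add: scaleC_complex_def)
        finally have f2: "form y (lie x z) = - form x (lie y z)" .
        show ?case
          by (simp add: tau0_bracket_mono f1 f2 add.assoc add.left_commute[of r k]
              lie_jacobi'[of x y z] cbilinearD[OF cbilinear_pure_tensor]
              scaleC_add_left scaleC_add_right sum.distrib)
      qed (simp add: tau0_bracket_add tau0_bracket_linear)
    qed (simp add: tau0_bracket_add tau0_bracket_linear)
  qed (simp add: tau0_bracket_add tau0_bracket_linear)
  from this[of "fst X" "fst Y" "fst Z"] show ?thesis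
    by (simp add: tau0_bracket_def)
qed

lemma tau0_deriv_mono:
  "tau0_deriv c (x \<otimes>\<^sub>C t_mono k, z) = (degree_val c k *\<^sub>C (x \<otimes>\<^sub>C t_mono k), zspace_deriv c z)"
  by (simp add: tau0_deriv_pure laurent_deriv_mono cbilinearD[OF cbilinear_pure_tensor])

lemma tau0_deriv_add:
  "tau0_deriv c (s + s', 0) = tau0_deriv c (s, 0) + tau0_deriv c (s', 0)"
  using clinearD(1)[OF clinear_tau0_deriv, of c "(s, 0)" "(s', 0)"] by simp

lemma tau0_bracket_deriv:
  fixes X Y :: "('g, 'n::finite) tau0"
  shows "tau0_deriv c (tau0_bracket form X Y)
    = tau0_bracket form (tau0_deriv c X) Y + tau0_bracket form X (tau0_deriv c Y)"
proof -
  have "tau0_deriv c (tau0_bracket form (s, 0) (t, 0))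
    = tau0_bracket form (tau0_deriv c (s, 0)) (t, 0) + tau0_bracket form (s, 0) (tau0_deriv c (t, 0))"
    for s t :: "('g, 'n laurent) tensor"
  proof (induction s rule: laurent_tensor_induct)
    case (mono x k)
    show ?case
    proof (induction t rule: laurent_tensor_induct)
      case (mono y r)
      have deg: "degree_val c (k + r) = degree_val c k + degree_val c r"
        by (simp add: degree_val_def sum.distrib algebra_simps)
      have z: "zspace_deriv c (l *\<^sub>C (\<Sum>i\<in>UNIV. of_int (k $ i) *\<^sub>C tK (k + r) i))
          = degree_val c (k + r) *\<^sub>C l *\<^sub>C (\<Sum>i\<in>UNIV. of_int (k $ i) *\<^sub>C tK (k + r) i)" for l
      proof -
        interpret L: Vector_Spaces.linear scaleC scaleC "zspace_deriv c"
          by (rule clinear_zspace_deriv)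
        show ?thesis
          by (simp add: L.sum L.scale zspace_deriv_tK cvs.scale_sum_right mult.commute mult.left_commute)
      qed
      have s: "(d *\<^sub>C p, 0) = d *\<^sub>C (p, 0)" for d and p :: "('g, 'n laurent) tensor"
        by (simp add: scaleC_prod_def)
      have z0: "zspace_deriv c 0 = 0"
        by (rule clinearD(3)[OF clinear_zspace_deriv])
      show ?case
        unfolding tau0_deriv_mono tau0_bracket_mono z z0 s tau0_bracket_linear
        by (simp add: scaleC_prod_def deg scaleC_add_left distrib_right)
    qed (simp add: tau0_bracket_add tau0_deriv_add tau0_bracket_linear clinearD[OF clinear_tau0_deriv])
  qed (simp add: tau0_bracket_add tau0_deriv_add tau0_bracket_linear clinearD[OF clinear_tau0_deriv])
  from this[of "fst X" "fst Y"] show ?thesis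
    by (simp add: tau0_bracket_def tau0_deriv_def)
qed

lemma tau0_deriv_commute:
  fixes X :: "('g, 'n::finite) tau0"
  shows "tau0_deriv c (tau0_deriv c' X) = tau0_deriv c' (tau0_deriv c X)"
proof -
  have lookup: "Poly_Mapping.lookup (omega_deriv c u) p = degree_val c (fst p) * Poly_Mapping.lookup u p"
    for c and u :: "'n omega" and p
    by (simp add: omega_deriv_def lin_ext_def case_prod_unfold lookup_sum lookup_single
        scaleC_complex_def when_def if_distrib[of "(*) _"] sum.delta in_keys_iff cong: if_cong)
  have "omega_deriv c (omega_deriv c' u) = omega_deriv c' (omega_deriv c u)" for u :: "'n omega"
    by (rule poly_mapping_eqI) (simp add: lookup)
  then have z: "zspace_deriv c (zspace_deriv c' z) = zspace_deriv c' (zspace_deriv c z)"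
    for z :: "'n zspace"
    by transfer (simp add: cvs.subspace_0 subspace_dA)
  have "tau0_deriv c (tau0_deriv c' (s, 0)) = tau0_deriv c' (tau0_deriv c (s, 0))"
    for s :: "('g, 'n laurent) tensor"
  proof (induction s rule: laurent_tensor_induct)
    case (mono x k)
    have s: "(d *\<^sub>C p, 0) = d *\<^sub>C (p, 0)" for d and p :: "('g, 'n laurent) tensor"
      by (simp add: scaleC_prod_def)
    have z0: "zspace_deriv c 0 = 0" for c :: "complex ^ ('n option)"
      by (rule clinearD(3)[OF clinear_zspace_deriv])
    show ?case
      unfolding tau0_deriv_mono z0 s clinearD(2)[OF clinear_tau0_deriv] by (simp add: mult.commute)
  qed (simp add: tau0_deriv_add clinearD[OF clinear_tau0_deriv])
  from this[of "fst X"] z[of "snd X"] show ?thesis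
    by (simp add: tau0_deriv_def)
qed

lemmas tau_bracket_linear = cbilinearD[OF cbilinear_tau_bracket[OF bilinear_form]]

lemma tau_bracket_antisym:
  fixes X Y :: "('g, 'n::finite, 'b::complex_comm_algebra) tau"
  shows "tau_bracket form X Y = - tau_bracket form Y X"
proof (induction X rule: tau_induct)
  case (tau0 S b)
  show ?case
  proof (induction Y rule: tau_induct)
    case (tau0 T b')
    show ?case
      using tau0_bracket_antisym[of S T]
      by (simp add: tau_bracket_generators[OF bilinear_form] pure_tensor_minus mult.commute)
  qed (simp_all add: tau_bracket_generators[OF bilinear_form] pure_tensor_minus tau_bracket_linear)
next
  case (D c)
  show ?case
    by (induction Y rule: tau_induct)
      (simp_all add: tau_bracket_generators[OF bilinear_form] pure_tensor_minus tau_bracket_linear)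
qed (simp add: tau_bracket_linear)

lemma tau_bracket_self:
  fixes X :: "('g, 'n::finite, 'b::complex_comm_algebra) tau"
  shows "tau_bracket form X X = 0"
proof -
  have "tau_bracket form X X + tau_bracket form X X = 0"
    using tau_bracket_antisym[of X X] by (simp add: eq_neg_iff_add_eq_0)
  then have "2 *\<^sub>C tau_bracket form X X = 0"
    using scaleC_add_left[of 1 1 "tau_bracket form X X"] by (simp add: scaleC_one)
  then show ?thesis by simp
qed

lemma tau_bracket_jacobi:
  fixes X Y Z :: "('g, 'n::finite, 'b::complex_comm_algebra) tau"
  shows "tau_bracket form X (tau_bracket form Y Z)
    = tau_bracket form (tau_bracket form X Y) Z + tau_bracket form Y (tau_bracket form X Z)"
proof -
  note gen = tau_bracket_generators[OF bilinear_form]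
  note tens = pure_tensor_minus pure_tensor_0 cbilinearD[OF cbilinear_pure_tensor]
    clinearD[OF clinear_tau0_deriv]
  have minus: "tau0_bracket form (- S) T = - tau0_bracket form S T"
    "tau0_bracket form S (- T) = - tau0_bracket form S T" for S T :: "('g, 'n) tau0"
    using tau0_bracket_linear(3)[of "-1" S T] tau0_bracket_linear(4)[of S "-1" T] by simp_all
  have zero: "tau_bracket form 0 W = 0" "tau_bracket form W 0 = 0"
    for W :: "('g, 'n, 'b) tau"
    using tau_bracket_linear(3)[of 0 0 W] tau_bracket_linear(4)[of W 0 0] by simp_all
  have neg: "tau_bracket form W (- t, 0) = - tau_bracket form W (t, 0)"
    "tau_bracket form (- t, 0) W = - tau_bracket form (t, 0) W"
    for W :: "('g, 'n, 'b) tau" and t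
    using tau_bracket_linear(4)[of W "-1" "(t, 0)"] tau_bracket_linear(3)[of "-1" "(t, 0)" W]
    by simp_all
  have diff: "(p - q) \<otimes>\<^sub>C r = p \<otimes>\<^sub>C r - q \<otimes>\<^sub>C r" for p q :: "('g, 'n) tau0" and r :: 'b
    using cbilinearD(1)[OF cbilinear_pure_tensor, of p "- q" r] by (simp add: pure_tensor_minus)
  show ?thesis
  proof (induction X rule: tau_induct)
    case (tau0 S b)
    show ?case
    proof (induction Y rule: tau_induct)
      case (tau0 T b')
      show ?case
      proof (induction Z rule: tau_induct)
        case (tau0 U b'')
        show ?case
          by (simp add: gen tau0_bracket_jacobi[of S T U] tens mult.assoc mult.left_commute[of b' b])
      next
        case (D c)
        show ?case
          by (simp add: gen tens minus neg diff tau0_bracket_deriv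
              tau0_bracket_antisym[of "tau0_deriv c S" T] mult.commute[of b' b])
      qed (simp add: tau_bracket_linear)
    next
      case (D c)
      show ?case
      proof (induction Z rule: tau_induct)
        case (tau0 U b'')
        show ?case
          by (simp add: gen tens minus neg diff tau0_bracket_deriv)
      next
        case (D c')
        show ?case
          by (simp add: gen zero tens neg tau0_deriv_commute[of c c'] flip: zero_prod_def)
      qed (simp add: tau_bracket_linear)
    qed (simp add: tau_bracket_linear)
  next
    case (D d)
    show ?case
    proof (induction Y rule: tau_induct)
      case (tau0 T b')
      show ?case
      proof (induction Z rule: tau_induct)
        case (tau0 U b'')
        show ?case
          by (simp add: gen tens tau0_bracket_deriv)
      next
        case (D c')
        show ?case
          by (simp add: gen zero tens neg tau0_deriv_commute[of d c'] flip: zero_prod_def)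
      qed (simp add: tau_bracket_linear)
    next
      case (D c)
      show ?case
      proof (induction Z rule: tau_induct)
        case (tau0 U b'')
        show ?case
          by (simp add: gen zero tens neg tau0_deriv_commute[of d c] flip: zero_prod_def)
      next
        case (D c')
        show ?case
          by (simp add: gen zero)
      qed (simp add: tau_bracket_linear)
    qed (simp add: tau_bracket_linear)
  qed (simp add: tau_bracket_linear)
qed

end

section \<open>Modules\<close>

definition tau_H :: "'g set \<Rightarrow>
    ('g::complex_lie_algebra, 'n::finite, 'b::complex_comm_algebra) tau set" where
  "tau_H h = cvs.span ((\<lambda>x. loop_elt x (t_mono 0) 1) ` h \<union> range K_elt \<union> range d_elt)"

definition tau_module :: "('g \<Rightarrow> 'g \<Rightarrow> complex) \<Rightarrow>
    (('g::complex_lie_algebra, 'n::finite, 'b::complex_comm_algebra) tau \<Rightarrow>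
      'v::complex_vector \<Rightarrow> 'v) \<Rightarrow> bool" where
  "tau_module form \<rho> \<longleftrightarrow> cbilinear \<rho>
     \<and> (\<forall>X Y v. \<rho> (tau_bracket form X Y) v = \<rho> X (\<rho> Y v) - \<rho> Y (\<rho> X v))"

definition acts_trivially :: "'l set \<Rightarrow> ('l \<Rightarrow> 'v::complex_vector \<Rightarrow> 'v) \<Rightarrow> bool" where
  "acts_trivially S \<rho> \<longleftrightarrow> (\<forall>X\<in>S. \<forall>v. \<rho> X v = 0)"

definition submodule :: "('l \<Rightarrow> 'v::complex_vector \<Rightarrow> 'v) \<Rightarrow> 'v set \<Rightarrow> bool" where
  "submodule \<rho> W \<longleftrightarrow> cvs.subspace W \<and> (\<forall>X. \<forall>w\<in>W. \<rho> X w \<in> W)"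

definition irreducible_module :: "('l \<Rightarrow> 'v::complex_vector \<Rightarrow> 'v) \<Rightarrow> bool" where
  "irreducible_module \<rho> \<longleftrightarrow>
     (\<exists>v::'v. v \<noteq> 0) \<and> (\<forall>W. submodule \<rho> W \<longrightarrow> W = {0} \<or> W = UNIV)"

definition weight_space :: "('l \<Rightarrow> 'v::complex_vector \<Rightarrow> 'v) \<Rightarrow> 'l set \<Rightarrow> ('l \<Rightarrow> complex) \<Rightarrow> 'v set" where
  "weight_space \<rho> H \<mu> = {v. \<forall>X\<in>H. \<rho> X v = \<mu> X *\<^sub>C v}"

definition internal_direct_sum :: "'i set \<Rightarrow> ('i \<Rightarrow> 'v::complex_vector set) \<Rightarrow> bool" where
  "internal_direct_sum I W \<longleftrightarrow>
     (\<forall>v. \<exists>!w :: 'i \<Rightarrow>\<^sub>0 'v. Poly_Mapping.keys w \<subseteq> I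
        \<and> (\<forall>i\<in>I. Poly_Mapping.lookup w i \<in> W i)
        \<and> v = (\<Sum>i\<in>Poly_Mapping.keys w. Poly_Mapping.lookup w i))"

definition integrable_module :: "'g set \<Rightarrow>
    (('g::complex_lie_algebra, 'n::finite, 'b::complex_comm_algebra) tau \<Rightarrow>
      'v::complex_vector \<Rightarrow> 'v) \<Rightarrow> bool" where
  "integrable_module h \<rho> \<longleftrightarrow>
     internal_direct_sum (cdual (tau_H h)) (weight_space \<rho> (tau_H h))
     \<and> (\<forall>\<alpha>\<in>roots h. \<forall>x\<in>root_space h \<alpha>. \<forall>m b v. \<exists>k. (\<rho> (loop_elt x (t_mono m) b) ^^ k) v = 0)"

end

theory Submission
  imports Defs
begin

text \<open>
  Take a root \<open>\<theta>\<close> and an sl2-triple \<open>e, f, t\<close> with \<open>e\<close> and \<open>f\<close> of weights \<open>\<theta>\<close> and \<open>-\<theta>\<close> and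
  \<open>(e, f) = 1\<close>.  For every exponent \<open>p\<close> the elements \<open>e \<otimes> t\<^sup>-\<^sup>p\<close> and \<open>f \<otimes> t\<^sup>p\<close> have the bracket
  \<open>t - \<Sum>\<^sub>i p\<^sub>i K\<^sub>i\<close>, which acts as \<open>t\<close> because the \<open>K\<^sub>i\<close> act trivially.  So all these pairs span sl2-triples
  with one and the same Cartan element.  Everything below rests on this.

  Some nonzero weight vector \<open>v\<close> is killed by all \<open>e \<otimes> t\<^sup>m \<otimes> b\<close>, by \<open>singular_vector_exists\<close>.  Start from a weight \<open>\<lambda>\<close>
  with \<open>Re \<lambda>(t) \<ge> 0\<close>, exchanging \<open>e\<close> and \<open>f\<close> if necessary.  By sl2-theory, \<open>f\<close> is injective, and even \<open>e f\<close> is, on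
  weight spaces on which \<open>t\<close> has an eigenvalue with positive real part.  So the dimensions of the weight spaces of weight
  \<open>\<lambda> + j\<theta>\<close> do not increase with \<open>j\<close> and become constant.  From there on \<open>f\<close> is bijective between
  neighbours and \<open>e\<close> injective, which contradicts the local nilpotency of \<open>e\<close> unless
  the constant is 0.  The injective operators \<open>f \<otimes> t\<^sup>m\<close> move any weight vector of weight \<open>\<lambda> + (j+1)\<theta> + \<delta>\<^sub>m\<close> to weight
  \<open>\<lambda> + j\<theta>\<close>, where \<open>\<delta>\<^sub>m\<close> is the weight of \<open>t\<^sup>m\<close>, so the weights of that form are bounded in \<open>j\<close>, uniformly in \<open>m\<close>,
  and a weight vector with the largest \<open>j\<close> can be taken for \<open>v\<close>.

  Now fix \<open>k\<close>, \<open>i\<close>, \<open>b\<close> and let \<open>z\<close> be the action of \<open>t\<^sup>k K\<^sub>i \<otimes> b\<close>.  For a natural number \<open>s\<close> let \<open>p = s\<epsilon>\<^sub>i\<close>, with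
  \<open>\<epsilon>\<^sub>i\<close> the unit exponent, \<open>E = e \<otimes> t\<^sup>p \<otimes> b\<close> and \<open>F = f \<otimes> t\<^sup>k\<^sup>-\<^sup>p\<close>.  Then \<open>[E, F] = t \<otimes> t\<^sup>k \<otimes> b + s z\<close>, and moving \<open>E\<close>
  to the right shows that \<open>E\<^sup>r F\<^sup>r v\<close> is a polynomial in \<open>s\<close> with leading term \<open>r! s\<^sup>r z\<^sup>r v\<close> (lemma
  \<open>E_power_F_power_leading\<close>).  For \<open>r = N + 1\<close>, where \<open>t v = N v\<close>, it vanishes for every \<open>s\<close>, because sl2-theory
  gives \<open>F\<^sup>N\<^sup>+\<^sup>1 v = 0\<close> with the same \<open>N\<close> for all \<open>s\<close>.  Hence \<open>z\<^sup>N\<^sup>+\<^sup>1 v = 0\<close> and \<open>z\<close> has a nonzero kernel.  The kernel of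
  \<open>z\<close> is a submodule, because \<open>z\<close> commutes with \<open>\<tau>\<^sub>0 \<otimes> B\<close> and is homogeneous for \<open>D\<close>.  So \<open>z = 0\<close> by irreducibility.
\<close>

section \<open>A root triple in the simple Lie algebra\<close>

text \<open>Subtracting \<open>a\<close> times the sum of the components from its image under \<open>T\<close> removes the
  component of eigenvalue \<open>a\<close> and only rescales the others by nonzero factors, so induction on the number of
  eigenvalues applies.\<close>

lemma eigencomponents_in_invariant_subspace:
  assumes W: "cvs.subspace W" and inv: "\<And>x. x \<in> W \<Longrightarrow> T x \<in> W" and T: "clinear T"
    and "finite C" and "\<And>c. c \<in> C \<Longrightarrow> T (u c) = c *\<^sub>C u c" and "(\<Sum>c\<in>C. u c) \<in> W"
  shows "\<forall>c\<in>C. u c \<in> W"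
  using assms(4-)
proof (induction C arbitrary: u rule: finite_induct)
  case (insert a C)
  let ?v = "\<Sum>c\<in>insert a C. u c"
  interpret T: Vector_Spaces.linear scaleC scaleC T by (rule T)
  have "T ?v - a *\<^sub>C ?v = (\<Sum>c\<in>insert a C. (c - a) *\<^sub>C u c)"
    using insert.prems(1) by (simp add: T.sum cvs.scale_sum_right cvs.scale_left_diff_distrib sum_subtractf)
  also have "\<dots> = (\<Sum>c\<in>C. (c - a) *\<^sub>C u c)"
    using insert.hyps by simp
  finally have "(\<Sum>c\<in>C. (c - a) *\<^sub>C u c) \<in> W"
    using cvs.subspace_diff[OF W inv[OF insert.prems(2)] cvs.subspace_scale[OF W insert.prems(2), of a]]
    by simp
  then have *: "\<forall>c\<in>C. (c - a) *\<^sub>C u c \<in> W"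
    using insert.prems(1) by (intro insert.IH) (simp_all add: T.scale mult.commute)
  have C: "u c \<in> W" if "c \<in> C" for c
  proof -
    have "inverse (c - a) *\<^sub>C (c - a) *\<^sub>C u c \<in> W"
      using * that by (blast intro: cvs.subspace_scale[OF W, of "(c - a) *\<^sub>C u c"])
    moreover have "c \<noteq> a"
      using that insert.hyps by blast
    ultimately show ?thesis by (simp add: scaleC_one)
  qed
  have "?v - (\<Sum>c\<in>C. u c) \<in> W"
    using cvs.subspace_diff[OF W insert.prems(2) cvs.subspace_sum[OF W, of C u]] C by blast
  then show ?case
    using C insert.hyps by simp
qed simp

lemma span_eigenvectors_decomposition:
  assumes T: "clinear T" and "x \<in> cvs.span {x. \<exists>c. T x = c *\<^sub>C x}"
  shows "\<exists>C u. finite C \<and> (\<forall>c\<in>C. T (u c) = c *\<^sub>C u c) \<and> x = (\<Sum>c\<in>C. u c)"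
  using assms(2)
proof (induction rule: cvs.span_induct_alt)
  case base
  show ?case by (rule exI[of _ "{}"]) simp
next
  case (step a x y)
  interpret T: Vector_Spaces.linear scaleC scaleC T by (rule T)
  from step obtain c C u where c: "T x = c *\<^sub>C x" and "finite C"
    and u: "\<And>c. c \<in> C \<Longrightarrow> T (u c) = c *\<^sub>C u c" and y: "y = (\<Sum>c\<in>C. u c)"
    by blast
  let ?u = "\<lambda>c'. (if c' \<in> C then u c' else 0) + (if c' = c then a *\<^sub>C x else 0)"
  have "T (?u c') = c' *\<^sub>C ?u c'" for c'
    by (simp add: T.add T.scale c u scaleC_add_right mult.commute)
  moreover have "a *\<^sub>C x + y = (\<Sum>c'\<in>insert c C. ?u c')"
  proof -
    have "(\<Sum>c'\<in>insert c C. if c' \<in> C then u c' else 0) = y"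
      unfolding y using \<open>finite C\<close> by (intro sum.mono_neutral_cong_right) auto
    then show ?thesis
      using \<open>finite C\<close> by (simp add: sum.distrib sum.delta add.commute)
  qed
  ultimately show ?case
    using \<open>finite C\<close> by (intro exI[of _ "insert c C"] exI[of _ ?u]) auto
qed

lemma clinear_lie: "clinear (lie x)"
  by (simp add: clinear_iff lie_add_right lie_scaleC_right)

text \<open>This replaces the root space decomposition.  If \<open>\<phi>\<close> is an eigenvector for the dual action of
  \<open>h\<close>, then for each \<open>z \<in> h\<close> it vanishes on all eigenspaces of \<open>ad z\<close> but the one of
  eigenvalue \<open>\<beta> z\<close>.  So \<open>y\<close> may be replaced by its component in this eigenspace, successively for
  the elements \<open>z\<close> of a basis of \<open>h\<close>; earlier eigenvalue conditions survive because \<open>h\<close> is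
  abelian.\<close>

lemma simultaneous_eigenvector_detected:
  fixes h :: "'g::complex_lie_algebra set" and form :: "'g \<Rightarrow> 'g \<Rightarrow> complex"
    and \<phi> :: "'g \<Rightarrow> complex"
  assumes inv: "invariant_form form" and fd: "finite_dimC (UNIV :: 'g set)" and h: "cartan_subalgebra h"
    and \<phi>: "clinear \<phi>" and \<phi>_ad: "\<And>z y. z \<in> h \<Longrightarrow> \<phi> (lie z y) = \<beta> z * \<phi> y"
    and \<beta>: "\<And>x y. x \<in> h \<Longrightarrow> y \<in> h \<Longrightarrow> \<beta> (x + y) = \<beta> x + \<beta> y"
      "\<And>c x. x \<in> h \<Longrightarrow> \<beta> (c *\<^sub>C x) = c * \<beta> x"
    and "\<phi> y0 \<noteq> 0"
  obtains y where "\<phi> y \<noteq> 0" and "\<And>z. z \<in> h \<Longrightarrow> lie z y = \<beta> z *\<^sub>C y"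
proof -
  have sub: "cvs.subspace h" and comm: "\<And>x y. x \<in> h \<Longrightarrow> y \<in> h \<Longrightarrow> lie x y = 0"
    and diag: "\<And>y. y \<in> h \<Longrightarrow> cvs.span {x. \<exists>c. lie y x = c *\<^sub>C x} = UNIV"
    using h unfolding cartan_subalgebra_def by blast+
  interpret \<phi>: Vector_Spaces.linear scaleC scaleC \<phi> by (rule \<phi>)
  obtain F :: "'g set" where F: "finite F" "UNIV = cvs.span F"
    using fd by (auto simp: finite_dimC_def)
  obtain S where S: "S \<subseteq> h" "cvs.independent S" "h \<subseteq> cvs.span S"
    by (rule cvs.basis_exists[of h]) (rule that)
  have "finite S"
    using cvs.independent_span_bound[OF F(1) S(2)] F(2) by blast
  have "\<exists>y. \<phi> y \<noteq> 0 \<and> (\<forall>z\<in>S'. lie z y = \<beta> z *\<^sub>C y)" if "S' \<subseteq> h" "finite S'" for S'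
    using that(2,1)
  proof (induction S' rule: finite_induct)
    case empty
    show ?case using \<open>\<phi> y0 \<noteq> 0\<close> by auto
  next
    case (insert z S')
    let ?W = "{y. \<forall>z\<in>S'. lie z y = \<beta> z *\<^sub>C y}"
    from insert obtain y where y: "\<phi> y \<noteq> 0" "y \<in> ?W" and z: "z \<in> h" and S': "S' \<subseteq> h" by auto
    have W: "cvs.subspace ?W"
      unfolding cvs.subspace_def
      by (auto simp: lie_add_right scaleC_add_right lie_scaleC_right mult.commute
          clinearD(3)[OF clinear_lie])
    have "lie z x \<in> ?W" if "x \<in> ?W" for x
    proof -
      have "lie z' (lie z x) = lie z (lie z' x)" if "z' \<in> S'" for z'
        using lie_jacobi'[OF inv, of z' z x] comm[of z' z] z S' that lie_scaleC_left[of 0 0 x]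
        by auto
      with that show ?thesis by (simp add: lie_scaleC_right)
    qed
    moreover obtain C u where Cu: "finite C" "\<And>c. c \<in> C \<Longrightarrow> lie z (u c) = c *\<^sub>C u c" "y = (\<Sum>c\<in>C. u c)"
      using span_eigenvectors_decomposition[OF clinear_lie, of y z] diag[OF z] by auto
    ultimately have uW: "\<forall>c\<in>C. u c \<in> ?W"
      using y(2) by (intro eigencomponents_in_invariant_subspace[OF W _ clinear_lie[of z]]) auto
    obtain c where c: "c \<in> C" "\<phi> (u c) \<noteq> 0"
      using y(1) sum.neutral[of C "\<lambda>c. \<phi> (u c)"] unfolding Cu(3) \<phi>.sum by blast
    have "c * \<phi> (u c) = \<beta> z * \<phi> (u c)"
      using \<phi>_ad[OF z, of "u c"] Cu(2)[OF c(1)] by (simp add: \<phi>.scale scaleC_complex_def)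
    then have "c = \<beta> z" using c(2) by simp
    with c uW Cu(2) show ?case by auto
  qed
  from this[OF S(1) \<open>finite S\<close>] obtain y where y: "\<phi> y \<noteq> 0" "\<And>z. z \<in> S \<Longrightarrow> lie z y = \<beta> z *\<^sub>C y"
    by blast
  have sp: "cvs.subspace {z \<in> h. lie z y = \<beta> z *\<^sub>C y}"
    unfolding cvs.subspace_def
    using cvs.subspace_0[OF sub] \<beta>(2)[of 0 0] lie_scaleC_left[of 0 0 y]
    by (auto simp: \<beta> lie_add_left lie_scaleC_left scaleC_add_left cvs.subspace_add[OF sub]
        cvs.subspace_scale[OF sub])
  have "h \<subseteq> {z \<in> h. lie z y = \<beta> z *\<^sub>C y}"
    using S y(2) by (intro order_trans[OF S(3)] cvs.span_minimal[OF _ sp]) auto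
  with y(1) that show thesis by blast
qed

text \<open>Pairing with \<open>e \<in> g\<^sub>\<theta>\<close> is an eigenvector of weight \<open>-\<theta>\<close> for the dual
  action of \<open>h\<close>, which gives \<open>f\<close>, and then \<open>[e, f]\<close> is the
  element of \<open>h\<close> that represents \<open>\<theta>\<close>.  It is the only such element since \<open>form\<close> is nondegenerate on \<open>h\<close>.  A root of squared length 2
  makes \<open>\<theta> t = 2\<close>, so that no rescaling is needed to get an sl2-triple.\<close>

lemma root_triple_exists:
  fixes h :: "'g::complex_lie_algebra set"
  assumes fd: "finite_dimC (UNIV :: 'g set)" and h: "cartan_subalgebra h" and nf: "normalized_form h form"
  obtains \<theta> e f t where "\<theta> \<in> roots h" "e \<in> root_space h \<theta>" "\<And>z. z \<in> h \<Longrightarrow> lie z f = (- \<theta> z) *\<^sub>C f"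
    "f \<noteq> 0" "t \<in> h" "lie e f = t" "form e f = 1" "\<theta> t = 2"
proof -
  have sub: "cvs.subspace h" and comm: "\<And>x y. x \<in> h \<Longrightarrow> y \<in> h \<Longrightarrow> lie x y = 0"
    and maxh: "\<And>x. (\<And>y. y \<in> h \<Longrightarrow> lie y x = 0) \<Longrightarrow> x \<in> h"
    using h unfolding cartan_subalgebra_def by blast+
  obtain \<theta> where inv: "invariant_form form" and \<theta>: "\<theta> \<in> roots h" "root_sqlen h form \<theta> = 2"
    using nf by (auto simp: normalized_form_def)
  note sym = form_sym[OF inv] and finv = form_inv[OF inv] and anti = lie_antisym[OF inv]
    and bil = cbilinearD[OF bilinear_form[OF inv]]
  have lin: "clinear (form x)" for x
    by (simp add: clinear_iff bil)
  have nondeg: "\<And>x. (\<And>y. form x y = 0) \<Longrightarrow> x = 0"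
    using inv by (auto simp: invariant_form_def)
  have \<theta>lin: "\<theta> (x + y) = \<theta> x + \<theta> y" "\<theta> (c *\<^sub>C x) = c * \<theta> x" if "x \<in> h" "y \<in> h" for x y c
    using \<theta>(1) that by (auto simp: roots_def cdual_def)
  have "0 \<in> root_space h \<theta>"
    by (simp add: root_space_def clinearD(3)[OF clinear_lie])
  then obtain e where e: "e \<in> root_space h \<theta>" "e \<noteq> 0"
    using \<theta>(1) by (auto simp: roots_def)
  then have eh: "\<And>z. z \<in> h \<Longrightarrow> lie z e = \<theta> z *\<^sub>C e"
    by (simp add: root_space_def)
  have form_e: "form e (lie z y) = - \<theta> z * form e y" if "z \<in> h" for z y
  proof -
    have "form e (lie z y) = form (- lie z e) y"
      using finv[of z e y] finv[of e z y] anti[of e z] by simp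
    also have "\<dots> = - \<theta> z * form e y"
      using bil(3)[of "- \<theta> z" e y] by (simp add: eh[OF that] scaleC_complex_def)
    finally show ?thesis .
  qed
  obtain y0 where y0: "form e y0 \<noteq> 0"
    using nondeg e(2) by blast
  obtain y where y: "form e y \<noteq> 0" "\<And>z. z \<in> h \<Longrightarrow> lie z y = (- \<theta> z) *\<^sub>C y"
    by (rule simultaneous_eigenvector_detected[OF inv fd h lin[of e], of "\<lambda>z. - \<theta> z", OF form_e _ _ y0])
      (simp_all add: \<theta>lin)
  define f where "f = inverse (form e y) *\<^sub>C y"
  have f: "form e f = 1" "\<And>z. z \<in> h \<Longrightarrow> lie z f = (- \<theta> z) *\<^sub>C f"
    using y by (simp_all add: f_def bil scaleC_complex_def lie_scaleC_right mult.commute)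
  define t where "t = lie e f"
  have t: "t \<in> h"
  proof (rule maxh)
    fix z assume z: "z \<in> h"
    show "lie z t = 0"
      unfolding t_def lie_jacobi'[OF inv, of z] eh[OF z] f(2)[OF z] lie_scaleC_left lie_scaleC_right
      by simp
  qed
  have form_t: "form t z = \<theta> z" if "z \<in> h" for z
  proof -
    have "form t z = form e (- lie z f)"
      using finv[of e f z] anti[of f z] by (simp add: t_def)
    also have "\<dots> = \<theta> z"
      by (simp add: f that bil scaleC_complex_def)
    finally show ?thesis .
  qed
  \<comment> \<open>An element of \<open>h\<close> orthogonal to \<open>h\<close> is orthogonal to everything: otherwise pairing with it would detect
     a vector of weight 0, and such vectors lie in \<open>h\<close>.\<close>
  have form_h_nondeg: "x = 0" if "x \<in> h" "\<And>y. y \<in> h \<Longrightarrow> form x y = 0" for x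
  proof (rule ccontr)
    assume "x \<noteq> 0"
    then obtain y0 where y0: "form x y0 \<noteq> 0" using nondeg by blast
    have form_x: "form x (lie z y) = 0 * form x y" if "z \<in> h" for z y
      using finv[of x z y] comm[of x z] \<open>x \<in> h\<close> that bil(3)[of 0 0 y] by simp
    obtain y where "form x y \<noteq> 0" "\<And>z. z \<in> h \<Longrightarrow> lie z y = 0 *\<^sub>C y"
      by (rule simultaneous_eigenvector_detected[OF inv fd h lin[of x], of "\<lambda>_. 0", OF form_x _ _ y0])
        simp_all
    with that maxh[of y] show False by simp
  qed
  have "(THE t. t \<in> h \<and> (\<forall>y\<in>h. form t y = \<theta> y)) = t"
  proof (rule the_equality)
    fix t' assume t': "t' \<in> h \<and> (\<forall>y\<in>h. form t' y = \<theta> y)"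
    have "form (t' - t) y = form t' y - form t y" for y
      using bil(1)[of "t' - t" t y] by simp
    then have "t' - t = 0"
      using t t' by (intro form_h_nondeg cvs.subspace_diff[OF sub]) (auto simp: form_t)
    then show "t' = t" by simp
  qed (simp add: t form_t)
  then have "\<theta> t = 2"
    using \<theta>(2) by (simp add: root_sqlen_def)
  moreover have "f \<noteq> 0"
    using f(1) bil(4)[of e 0 0] by auto
  ultimately show thesis
    using that \<theta>(1) e(1) f t t_def by blast
qed

section \<open>Linear algebra\<close>

text \<open>Stated for finite dimensional subspaces of a space of arbitrary dimension, as needed for weight spaces.\<close>

lemma injective_onto_if_dim_not_smaller:
  assumes "cvs.subspace U" "cvs.subspace W" "finite_dimC U" "finite_dimC W" and T: "clinear T"
    and into: "\<And>u. u \<in> U \<Longrightarrow> T u \<in> W" and inj: "\<And>u. u \<in> U \<Longrightarrow> T u = 0 \<Longrightarrow> u = 0"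
  shows "cvs.dim U \<le> cvs.dim W" and "cvs.dim W \<le> cvs.dim U \<Longrightarrow> T ` U = W"
proof -
  interpret T: Vector_Spaces.linear scaleC scaleC T by (rule T)
  obtain B where B: "B \<subseteq> U" "cvs.independent B" "U \<subseteq> cvs.span B" "card B = cvs.dim U"
    by (rule cvs.basis_exists[of U]) (rule that)
  obtain C where C: "C \<subseteq> W" "cvs.independent C" "W \<subseteq> cvs.span C" "card C = cvs.dim W"
    by (rule cvs.basis_exists[of W]) (rule that)
  obtain S where S: "finite S" "U \<subseteq> cvs.span S"
    using assms(3) by (auto simp: finite_dimC_def)
  obtain S' where S': "finite S'" "W \<subseteq> cvs.span S'"
    using assms(4) by (auto simp: finite_dimC_def)
  have "finite B"
    using cvs.independent_span_bound[OF S(1) B(2)] B(1) S(2) by blast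
  have "finite C"
    using cvs.independent_span_bound[OF S'(1) C(2)] C(1) S'(2) by blast
  have "inj_on T U"
    using inj cvs.subspace_diff[OF assms(1)] by (intro inj_onI) (metis T.diff eq_iff_diff_eq_0)
  moreover have "cvs.span B = U"
    using B assms(1) cvs.span_minimal by blast
  ultimately have indep: "cvs.independent (T ` B)" and injB: "inj_on T B"
    using T.independent_injective_image[OF B(2)] inj_on_subset[OF _ B(1)] by auto
  have TB: "T ` B \<subseteq> W"
    using B(1) into by blast
  have bound: "card D \<le> cvs.dim W" if "cvs.independent D" "D \<subseteq> W" for D
    using cvs.independent_span_bound[OF \<open>finite C\<close> that(1)] that(2) C(3,4) by auto
  show "cvs.dim U \<le> cvs.dim W"
    using bound[OF indep TB] card_image[OF injB] B(4) by simp
  assume dim: "cvs.dim W \<le> cvs.dim U"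
  show "T ` U = W"
  proof
    show "W \<subseteq> T ` U"
    proof
      fix w assume w: "w \<in> W"
      have "w \<in> cvs.span (T ` B)"
      proof (rule ccontr)
        assume not: "w \<notin> cvs.span (T ` B)"
        then have "cvs.independent (insert w (T ` B))"
          by (rule cvs.independent_insertI[OF _ indep])
        moreover have "insert w (T ` B) \<subseteq> W"
          using w TB by simp
        ultimately have "card (insert w (T ` B)) \<le> cvs.dim W"
          by (rule bound)
        moreover have "w \<notin> T ` B"
          using not cvs.span_base[of w "T ` B"] by blast
        ultimately show False
          using dim card_image[OF injB] B(4) \<open>finite B\<close> by simp
      qed
      then show "w \<in> T ` U"
        using \<open>cvs.span B = U\<close> by (simp add: T.span_image)
    qed
  qed (use into in blast)
qed

text \<open>If \<open>w\<close> were nonzero, a linear functional that is 1 on \<open>w\<close> would turn the identity into a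
  monic complex polynomial with infinitely many roots.\<close>

lemma polynomial_identity_top_zero:
  fixes w :: "'v::complex_vector"
  assumes "\<And>s::nat. of_nat s ^ r *\<^sub>C w = (\<Sum>a<r. of_nat s ^ a *\<^sub>C c a)"
  shows "w = 0"
proof (rule ccontr)
  assume "w \<noteq> 0"
  then have "cvs.independent {w}"
    by simp
  interpret VC: vector_space_pair "scaleC :: complex \<Rightarrow> 'v \<Rightarrow> 'v" "scaleC :: complex \<Rightarrow> complex \<Rightarrow> complex" ..
  obtain \<phi> :: "'v \<Rightarrow> complex" where \<phi>: "clinear \<phi>" "\<phi> w = 1"
    using VC.linear_independent_extend[OF \<open>cvs.independent {w}\<close>, of "\<lambda>_. 1"] by auto
  interpret \<phi>: Vector_Spaces.linear scaleC scaleC \<phi> by (rule \<phi>)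
  define d where "d a = (if a = r then 1 else - \<phi> (c a))" for a
  have "(\<Sum>a\<le>r. d a * of_nat s ^ a) = 0" for s :: nat
  proof -
    have "\<phi> (of_nat s ^ r *\<^sub>C w) = \<phi> (\<Sum>a<r. of_nat s ^ a *\<^sub>C c a)"
      using assms by simp
    then have "of_nat s ^ r = (\<Sum>a<r. \<phi> (c a) * of_nat s ^ a)"
      by (simp add: \<phi>.sum \<phi>.scale scaleC_complex_def \<phi>(2) mult.commute)
    moreover have "(\<Sum>a\<le>r. d a * of_nat s ^ a) = of_nat s ^ r - (\<Sum>a<r. \<phi> (c a) * of_nat s ^ a)"
      unfolding lessThan_Suc_atMost[symmetric] by (simp add: d_def sum_negf)
    ultimately show ?thesis by simp
  qed
  then have "range (of_nat :: nat \<Rightarrow> complex) \<subseteq> {z. (\<Sum>a\<le>r. d a * z ^ a) = 0}"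
    by auto
  moreover have "infinite (range (of_nat :: nat \<Rightarrow> complex))"
    using infinite_UNIV_nat by (simp add: finite_image_iff inj_of_nat)
  moreover have "finite {z. (\<Sum>a\<le>r. d a * z ^ a) = 0}"
    using Transcendental.polyfun_rootbound[of d r r] by (simp add: d_def)
  ultimately show False
    using finite_subset by blast
qed

section \<open>Locally nilpotent sl2-triples\<close>

locale sl2_triple =
  fixes E F T :: "'v::complex_vector \<Rightarrow> 'v"
  assumes linear: "clinear E" "clinear F" "clinear T"
    and EF: "E (F v) = F (E v) + T v"
    and TE: "T (E v) = E (T v) + 2 *\<^sub>C E v"
    and TF: "T (F v) = F (T v) - 2 *\<^sub>C F v"
    and E_nilpotent: "\<exists>k. (E ^^ k) v = 0"
    and F_nilpotent: "\<exists>k. (F ^^ k) v = 0"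
begin

lemmas E_linear = clinearD[OF linear(1)]
lemmas F_linear = clinearD[OF linear(2)]
lemmas T_linear = clinearD[OF linear(3)]

lemma E_power_zero [simp]: "(E ^^ k) 0 = 0"
  by (induction k) (simp_all add: E_linear)

text \<open>The standard relation \<open>E\<^sup>l\<^sup>+\<^sup>1 F = F E\<^sup>l\<^sup>+\<^sup>1 + (l+1) E\<^sup>l (T +
  l)\<close>, evaluated on an eigenvector of \<open>T\<close>.\<close>

lemma E_power_F:
  assumes "T v = N *\<^sub>C v"
  shows "(E ^^ Suc l) (F v) = F ((E ^^ Suc l) v) + (of_nat (Suc l) * (N + of_nat l)) *\<^sub>C (E ^^ l) v"
    and "T ((E ^^ l) v) = (N + 2 * of_nat l) *\<^sub>C (E ^^ l) v"
proof -
  show T: "T ((E ^^ l) v) = (N + 2 * of_nat l) *\<^sub>C (E ^^ l) v" for l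
    using assms by (induction l) (simp_all add: TE E_linear algebra_simps flip: scaleC_add_left)
  show "(E ^^ Suc l) (F v) = F ((E ^^ Suc l) v) + (of_nat (Suc l) * (N + of_nat l)) *\<^sub>C (E ^^ l) v"
  proof (induction l)
    case 0
    show ?case using assms by (simp add: EF)
  next
    case (Suc l)
    have "(E ^^ Suc (Suc l)) (F v)
        = E (F ((E ^^ Suc l) v)) + (of_nat (Suc l) * (N + of_nat l)) *\<^sub>C (E ^^ Suc l) v"
      unfolding funpow.simps(2)[of "Suc l"] comp_apply Suc by (simp add: E_linear)
    also have "\<dots> = F ((E ^^ Suc (Suc l)) v) + ((N + 2 * of_nat (Suc l)) *\<^sub>C (E ^^ Suc l) v
        + (of_nat (Suc l) * (N + of_nat l)) *\<^sub>C (E ^^ Suc l) v)"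
      unfolding EF T by (simp add: add.assoc)
    also have "(N + 2 * of_nat (Suc l)) *\<^sub>C (E ^^ Suc l) v
        + (of_nat (Suc l) * (N + of_nat l)) *\<^sub>C (E ^^ Suc l) v
        = (of_nat (Suc (Suc l)) * (N + of_nat (Suc l))) *\<^sub>C (E ^^ Suc l) v"
      unfolding scaleC_add_left[symmetric] by (simp add: algebra_simps)
    finally show ?case .
  qed
qed

text \<open>Let \<open>E\<^sup>l v\<close> be the last nonzero vector among the \<open>E\<^sup>k v\<close>.  Then
  \<open>E\<^sup>l\<^sup>+\<^sup>1 F v\<close> is a multiple of it by \<open>(l+1)(N+l)\<close>, which is not 0.\<close>

lemma E_F_nonzero:
  assumes v: "T v = N *\<^sub>C v" "v \<noteq> 0" and N: "Re N > 0"
  shows "E (F v) \<noteq> 0"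
proof
  assume 0: "E (F v) = 0"
  define k where "k = (LEAST k. (E ^^ k) v = 0)"
  have k: "(E ^^ k) v = 0"
    unfolding k_def using E_nilpotent by (rule LeastI_ex)
  then have "k \<noteq> 0" using v by (intro notI) simp
  then obtain l where l: "k = Suc l" by (cases k) auto
  have nz: "(E ^^ l) v \<noteq> 0"
    using not_less_Least[of l "\<lambda>k. (E ^^ k) v = 0"] l by (simp add: k_def)
  have "(E ^^ Suc l) (F v) = 0"
    using 0 by (simp add: funpow_Suc_right del: funpow.simps)
  then have "of_nat (Suc l) * (N + of_nat l) = 0"
    using E_power_F(1)[OF v(1), of l] k nz by (simp add: l F_linear)
  then have "N = - of_nat l"
    by (simp only: mult_eq_0_iff of_nat_eq_0_iff nat.distinct eq_neg_iff_add_eq_0 simp_thms)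
  with N show False by simp
qed

lemma F_nonzero:
  assumes "T v = N *\<^sub>C v" "v \<noteq> 0" "Re N > 0"
  shows "F v \<noteq> 0"
  using E_F_nonzero[OF assms] by (auto simp: E_linear)

text \<open>The exponent is determined by the eigenvalue \<open>N\<close> alone.  This is what later makes it the same for all the
  triples that share \<open>T\<close>.\<close>

lemma F_power_highest:
  assumes v: "T v = N *\<^sub>C v" "v \<noteq> 0" "E v = 0"
  shows "\<exists>r. N = of_nat r \<and> (F ^^ Suc r) v = 0"
proof -
  have T: "T ((F ^^ l) v) = (N - 2 * of_nat l) *\<^sub>C (F ^^ l) v" for l
    using v(1) by (induction l) (simp_all add: TF F_linear algebra_simps flip: cvs.scale_left_diff_distrib)
  have EF_power: "E ((F ^^ Suc l) v) = (of_nat (Suc l) * (N - of_nat l)) *\<^sub>C (F ^^ l) v" for l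
  proof (induction l)
    case 0
    show ?case using v by (simp add: EF F_linear)
  next
    case (Suc l)
    have "E ((F ^^ Suc (Suc l)) v)
        = F ((of_nat (Suc l) * (N - of_nat l)) *\<^sub>C (F ^^ l) v) + (N - 2 * of_nat (Suc l)) *\<^sub>C (F ^^ Suc l) v"
      unfolding funpow.simps(2)[of "Suc l"] comp_apply EF Suc T by simp
    also have "\<dots> = (of_nat (Suc l) * (N - of_nat l) + (N - 2 * of_nat (Suc l))) *\<^sub>C (F ^^ Suc l) v"
      by (simp add: F_linear scaleC_add_left)
    also have "of_nat (Suc l) * (N - of_nat l) + (N - 2 * of_nat (Suc l))
        = of_nat (Suc (Suc l)) * (N - of_nat (Suc l))"
      by (simp add: algebra_simps)
    finally show ?case .
  qed
  define k where "k = (LEAST k. (F ^^ k) v = 0)"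
  have k: "(F ^^ k) v = 0"
    unfolding k_def using F_nilpotent by (rule LeastI_ex)
  then have "k \<noteq> 0" using v by (intro notI) simp
  then obtain l where l: "k = Suc l" by (cases k) auto
  have nz: "(F ^^ l) v \<noteq> 0"
    using not_less_Least[of l "\<lambda>k. (F ^^ k) v = 0"] l by (simp add: k_def)
  have "of_nat (Suc l) * (N - of_nat l) = 0"
    using EF_power[of l] k nz by (simp add: l E_linear)
  then have "N = of_nat l"
    by (simp only: mult_eq_0_iff of_nat_eq_0_iff nat.distinct right_minus_eq simp_thms)
  with k l show ?thesis by blast
qed

end

section \<open>Words in lowering operators\<close>

text \<open>
  The relations between \<open>E\<^sub>s = e \<otimes> t\<^sup>p \<otimes> b\<close>, \<open>F\<^sub>s\<^sub>,\<^sub>j = f \<otimes> t\<^sup>(\<^sup>j\<^sup>+\<^sup>1\<^sup>)\<^sup>k\<^sup>-\<^sup>p \<otimes> b\<^sup>j\<close>, \<open>H\<^sub>j = t \<otimes> t\<^sup>j\<^sup>k \<otimes> b\<^sup>j\<close> and \<open>Z\<^sub>j = t\<^sup>j\<^sup>k K\<^sub>i \<otimes> b\<^sup>j\<close>, where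
  \<open>p = s\<epsilon>\<^sub>i\<close>, with \<open>S\<close> the space of vectors killed by \<open>e \<otimes> A \<otimes> B\<close>.  The operators \<open>H\<^sub>j\<close> and \<open>Z\<^sub>j\<close> and the space \<open>S\<close> do not
  depend on the parameter \<open>s\<close>, so all dependence on \<open>s\<close> disappears, apart from explicit powers, once no \<open>F\<close> is left.
\<close>

locale lowering_family =
  fixes E :: "nat \<Rightarrow> 'v::complex_vector \<Rightarrow> 'v" and F :: "nat \<Rightarrow> nat \<Rightarrow> 'v \<Rightarrow> 'v"
    and H Z :: "nat \<Rightarrow> 'v \<Rightarrow> 'v" and S :: "'v set"
  assumes linear: "clinear (E s)" "clinear (F s j)" "clinear (H j)" "clinear (Z j)"
    and EF: "E s (F s j v) = F s j (E s v) + H (Suc j) v + of_nat s *\<^sub>C Z (Suc j) v"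
    and HF: "H a (F s j v) = F s j (H a v) - 2 *\<^sub>C F s (a + j) v"
    and ZF: "Z a (F s j v) = F s j (Z a v)"
    and ES: "u \<in> S \<Longrightarrow> E s u = 0" and HS: "u \<in> S \<Longrightarrow> H a u \<in> S" and ZS: "u \<in> S \<Longrightarrow> Z a u \<in> S"
begin

lemmas E_linear = clinearD[OF linear(1)]
lemmas F_linear = clinearD[OF linear(2)]
lemmas H_linear = clinearD[OF linear(3)]
lemmas Z_linear = clinearD[OF linear(4)]

text \<open>The functions of \<open>s\<close> that are sums of terms \<open>s\<^sup>a F\<^sub>s\<^sub>,\<^sub>j\<^sub>1 \<dots>
  F\<^sub>s\<^sub>,\<^sub>j\<^sub>r u\<close> with \<open>u \<in> S\<close> and \<open>a \<le> d\<close>: words of length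
  \<open>r\<close> with polynomial coefficients of degree at most \<open>d\<close>.  For \<open>r = 0\<close> they are the
  polynomials in \<open>s\<close> with coefficients in the span of \<open>S\<close>.\<close>

inductive words :: "nat \<Rightarrow> nat \<Rightarrow> (nat \<Rightarrow> 'v) \<Rightarrow> bool" where
  base: "u \<in> S \<Longrightarrow> words 0 0 (\<lambda>_. u)"
| lower: "words d r g \<Longrightarrow> words d (Suc r) (\<lambda>s. F s j (g s))"
| add: "words d r g \<Longrightarrow> words d r g' \<Longrightarrow> words d r (\<lambda>s. g s + g' s)"
| scale: "words d r g \<Longrightarrow> words d r (\<lambda>s. c *\<^sub>C g s)"
| param: "words d r g \<Longrightarrow> words (Suc d) r (\<lambda>s. of_nat s *\<^sub>C g s)"
| weaken: "words d r g \<Longrightarrow> words (Suc d) r g"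

lemma words_H: "words d r g \<Longrightarrow> words d r (\<lambda>s. H a (g s))"
proof (induction rule: words.induct)
  case (lower d r g j)
  have "words d (Suc r) (\<lambda>s. F s j (H a (g s)) + (-2) *\<^sub>C F s (a + j) (g s))"
    using lower by (intro words.add words.scale words.lower)
  then show ?case by (simp add: HF)
qed (auto simp: H_linear intro: words.intros HS)

lemma words_Z: "words d r g \<Longrightarrow> words d r (\<lambda>s. Z a (g s))"
  by (induction rule: words.induct) (auto simp: Z_linear ZF intro: words.intros ZS)

text \<open>Each \<open>E\<close> uses up one letter \<open>F\<close> and raises the degree in \<open>s\<close> by at most
  one.\<close>

lemma words_E_cases:
  "words d r g \<Longrightarrow> (case r of 0 \<Rightarrow> \<forall>s. E s (g s) = 0 | Suc r' \<Rightarrow> words (Suc d) r' (\<lambda>s. E s (g s)))"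
proof (induction rule: words.induct)
  case (lower d r g j)
  have *: "words (Suc d) r (\<lambda>s. H (Suc j) (g s) + of_nat s *\<^sub>C Z (Suc j) (g s))"
    using lower by (intro words.add words.param) (auto intro: words.weaken words_H words_Z)
  show ?case
  proof (cases r)
    case 0
    with * lower.IH show ?thesis by (simp add: EF F_linear)
  next
    case (Suc r')
    then have "words (Suc d) r (\<lambda>s. F s j (E s (g s)))"
      using lower.IH words.lower by simp
    from words.add[OF this *] show ?thesis by (simp add: EF add.assoc)
  qed
qed (auto simp: E_linear ES intro: words.intros split: nat.splits)

lemma words_E: "words d (Suc r) g \<Longrightarrow> words (Suc d) r (\<lambda>s. E s (g s))"
  using words_E_cases by fastforce

lemma words_E_power: "words d (m + r) g \<Longrightarrow> words (d + m) r (\<lambda>s. (E s ^^ m) (g s))"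
proof (induction m arbitrary: d g)
  case (Suc m)
  from Suc.IH[OF words_E] Suc.prems show ?case
    by (simp add: funpow_Suc_right del: funpow.simps)
qed simp

lemma words_F_power: "u \<in> S \<Longrightarrow> words 0 r (\<lambda>s. (F s 0 ^^ r) u)"
  by (induction r) (auto intro: words.intros)

lemma words_polynomial:
  assumes "words d 0 g"
  shows "\<exists>c. \<forall>s. g s = (\<Sum>a\<le>d. of_nat s ^ a *\<^sub>C c a)"
proof -
  have "\<exists>c. \<forall>s. g s = (\<Sum>a\<le>d. of_nat s ^ a *\<^sub>C c a)" if "words d r g" "r = 0" for r
    using that
  proof (induction rule: words.induct)
    case (base u)
    then show ?case by (intro exI[of _ "\<lambda>_. u"]) (simp add: scaleC_one)
  next
    case (add d r g g')
    then obtain c c' where "\<forall>s. g s = (\<Sum>a\<le>d. of_nat s ^ a *\<^sub>C c a)"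
      "\<forall>s. g' s = (\<Sum>a\<le>d. of_nat s ^ a *\<^sub>C c' a)" by blast
    then show ?case
      by (intro exI[of _ "\<lambda>a. c a + c' a"]) (simp add: scaleC_add_right sum.distrib)
  next
    case (scale d r g b)
    then obtain c where "\<forall>s. g s = (\<Sum>a\<le>d. of_nat s ^ a *\<^sub>C c a)" by blast
    then show ?case
      by (intro exI[of _ "\<lambda>a. b *\<^sub>C c a"]) (simp add: cvs.scale_sum_right mult.commute)
  next
    case (param d r g)
    then obtain c where "\<forall>s. g s = (\<Sum>a\<le>d. of_nat s ^ a *\<^sub>C c a)" by blast
    then show ?case
      by (intro exI[of _ "case_nat 0 c"])
        (simp add: sum.atMost_Suc_shift cvs.scale_sum_right del: sum.atMost_Suc)
  next
    case (weaken d r g)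
    then obtain c where "\<forall>s. g s = (\<Sum>a\<le>d. of_nat s ^ a *\<^sub>C c a)" by blast
    then show ?case
      by (intro exI[of _ "c(Suc d := 0)"]) simp
  qed simp
  with assms show ?thesis by blast
qed

lemma E_power_linear: "(E s ^^ k) (x + y) = (E s ^^ k) x + (E s ^^ k) y"
  "(E s ^^ k) (c *\<^sub>C x) = c *\<^sub>C (E s ^^ k) x" "(E s ^^ k) 0 = 0"
  by (induction k) (simp_all add: E_linear)

lemma Z_F_power: "Z a ((F s j ^^ r) u) = (F s j ^^ r) (Z a u)"
  by (induction r) (simp_all add: ZF)

text \<open>Modulo terms without a factor \<open>s\<close>, the operator \<open>E\<close> replaces each of the \<open>r+1\<close>
  letters in turn by the central \<open>s Z\<^sub>1\<close>.\<close>

lemma E_F_power_leading: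
  assumes "u \<in> S"
  shows "words 0 r (\<lambda>s. E s ((F s 0 ^^ Suc r) u) - (of_nat (Suc r) * of_nat s) *\<^sub>C (F s 0 ^^ r) (Z 1 u))"
proof (induction r)
  case 0
  have "words 0 0 (\<lambda>s. H 1 u)"
    using assms by (intro words.base HS)
  then show ?case by (simp add: EF ES[OF assms] F_linear)
next
  case (Suc r)
  let ?d = "\<lambda>s. E s ((F s 0 ^^ Suc r) u) - (of_nat (Suc r) * of_nat s) *\<^sub>C (F s 0 ^^ r) (Z 1 u)"
  have "words 0 (Suc r) (\<lambda>s. F s 0 (?d s) + H 1 ((F s 0 ^^ Suc r) u))"
    using Suc by (intro words.add words.lower words_H words_F_power assms)
  moreover have "F s 0 (?d s) + H 1 ((F s 0 ^^ Suc r) u)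
      = E s ((F s 0 ^^ Suc (Suc r)) u) - (of_nat (Suc (Suc r)) * of_nat s) *\<^sub>C (F s 0 ^^ Suc r) (Z 1 u)" for s
  proof -
    have "E s ((F s 0 ^^ Suc (Suc r)) u)
        = F s 0 (E s ((F s 0 ^^ Suc r) u)) + H 1 ((F s 0 ^^ Suc r) u) + of_nat s *\<^sub>C (F s 0 ^^ Suc r) (Z 1 u)"
      unfolding funpow.simps(2)[of "Suc r"] comp_apply EF One_nat_def Z_F_power ..
    moreover have "(of_nat (Suc (Suc r)) * of_nat s) *\<^sub>C (F s 0 ^^ Suc r) (Z 1 u)
        = of_nat s *\<^sub>C (F s 0 ^^ Suc r) (Z 1 u) + (of_nat (Suc r) * of_nat s) *\<^sub>C (F s 0 ^^ Suc r) (Z 1 u)"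
      unfolding scaleC_add_left[symmetric] by (simp add: distrib_right)
    moreover have "F s 0 (?d s) = F s 0 (E s ((F s 0 ^^ Suc r) u))
        - (of_nat (Suc r) * of_nat s) *\<^sub>C (F s 0 ^^ Suc r) (Z 1 u)"
      by (simp add: F_linear)
    ultimately show ?thesis by (simp del: funpow.simps of_nat_Suc)
  qed
  ultimately show ?case by simp
qed

text \<open>Iterating the previous lemma on \<open>u, Z\<^sub>1 u, Z\<^sub>1\<^sup>2 u, \<dots>\<close>: one \<open>E\<close>
  contributes the factor \<open>(r+1) s Z\<^sub>1\<close> and an error of degree 0, which the remaining \<open>r\<close> operators
  \<open>E\<close> raise to degree at most \<open>r\<close>.\<close>

lemma E_power_F_power_leading:
  assumes "u \<in> S"
  shows "words r 0 (\<lambda>s. (E s ^^ Suc r) ((F s 0 ^^ Suc r) u)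
    - (fact (Suc r) * of_nat s ^ Suc r) *\<^sub>C (Z 1 ^^ Suc r) u)"
  using assms
proof (induction r arbitrary: u)
  case 0
  then show ?case using E_F_power_leading[of u 0] by simp
next
  case (Suc r)
  let ?d = "\<lambda>s. E s ((F s 0 ^^ Suc (Suc r)) u)
    - (of_nat (Suc (Suc r)) * of_nat s) *\<^sub>C (F s 0 ^^ Suc r) (Z 1 u)"
  let ?d' = "\<lambda>s. (E s ^^ Suc r) ((F s 0 ^^ Suc r) (Z 1 u))
    - (fact (Suc r) * of_nat s ^ Suc r) *\<^sub>C (Z 1 ^^ Suc r) (Z 1 u)"
  have "words (0 + Suc r) 0 (\<lambda>s. (E s ^^ Suc r) (?d s))"
    using E_F_power_leading[OF Suc.prems, of "Suc r"] by (intro words_E_power) simp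
  moreover have "words (Suc r) 0 (\<lambda>s. of_nat (Suc (Suc r)) *\<^sub>C of_nat s *\<^sub>C ?d' s)"
    by (intro words.scale words.param Suc.IH ZS Suc.prems)
  ultimately have "words (Suc r) 0 (\<lambda>s. (E s ^^ Suc r) (?d s) + of_nat (Suc (Suc r)) *\<^sub>C of_nat s *\<^sub>C ?d' s)"
    using words.add by simp
  moreover have "(E s ^^ Suc r) (?d s) + of_nat (Suc (Suc r)) *\<^sub>C of_nat s *\<^sub>C ?d' s
      = (E s ^^ Suc (Suc r)) ((F s 0 ^^ Suc (Suc r)) u)
        - (fact (Suc (Suc r)) * of_nat s ^ Suc (Suc r)) *\<^sub>C (Z 1 ^^ Suc (Suc r)) u" for s
  proof -
    let ?x = "(E s ^^ Suc r) ((F s 0 ^^ Suc r) (Z 1 u))" and ?c = "of_nat (Suc (Suc r)) * of_nat s :: complex"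
    have E: "(E s ^^ Suc (Suc r)) w = (E s ^^ Suc r) (E s w)" for w
      unfolding funpow_Suc_right comp_apply ..
    have Z: "(Z 1 ^^ Suc (Suc r)) u = (Z 1 ^^ Suc r) (Z 1 u)"
      unfolding funpow_Suc_right comp_apply ..
    have "(E s ^^ Suc (Suc r)) ((F s 0 ^^ Suc (Suc r)) u) = (E s ^^ Suc r) (?d s + ?c *\<^sub>C (F s 0 ^^ Suc r) (Z 1 u))"
      unfolding E by simp
    also have "\<dots> = (E s ^^ Suc r) (?d s) + ?c *\<^sub>C ?x"
      unfolding E_power_linear ..
    finally have 1: "(E s ^^ Suc (Suc r)) ((F s 0 ^^ Suc (Suc r)) u) = (E s ^^ Suc r) (?d s) + ?c *\<^sub>C ?x" .
    have "?c * (fact (Suc r) * of_nat s ^ Suc r) = fact (Suc (Suc r)) * of_nat s ^ Suc (Suc r)"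
      by (simp add: algebra_simps)
    then have 2: "of_nat (Suc (Suc r)) *\<^sub>C of_nat s *\<^sub>C ?d' s
        = ?c *\<^sub>C ?x - (fact (Suc (Suc r)) * of_nat s ^ Suc (Suc r)) *\<^sub>C (Z 1 ^^ Suc r) (Z 1 u)"
      unfolding cvs.scale_right_diff_distrib scaleC_scaleC mult.assoc[symmetric] by simp
    show ?thesis unfolding 1 2 Z by simp
  qed
  ultimately show ?case by simp
qed

lemma Z_nilpotent:
  assumes "u \<in> S" and "\<And>s. (F s 0 ^^ Suc r) u = 0"
  shows "(Z 1 ^^ Suc r) u = 0"
proof -
  obtain c where "\<And>s. (E s ^^ Suc r) ((F s 0 ^^ Suc r) u)
      - (fact (Suc r) * of_nat s ^ Suc r) *\<^sub>C (Z 1 ^^ Suc r) u = (\<Sum>a\<le>r. of_nat s ^ a *\<^sub>C c a)"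
    using words_polynomial[OF E_power_F_power_leading[OF assms(1), of r]] by blast
  then have "of_nat s ^ Suc r *\<^sub>C (- fact (Suc r) *\<^sub>C (Z 1 ^^ Suc r) u) = (\<Sum>a<Suc r. of_nat s ^ a *\<^sub>C c a)" for s
    by (simp add: assms(2) E_power_linear lessThan_Suc_atMost mult.commute del: funpow.simps fact_Suc sum.lessThan_Suc power_Suc)
  then have "- fact (Suc r) *\<^sub>C (Z 1 ^^ Suc r) u = 0"
    by (rule polynomial_identity_top_zero)
  then show ?thesis by (simp del: fact_Suc funpow.simps)
qed

end

section \<open>Level zero modules\<close>

lemma tau_bracket_loop_loop:
  fixes b b' :: "'b::complex_comm_algebra" and k r :: "'n::finite expo"
  assumes "invariant_form form"
  shows "tau_bracket form (loop_elt x (t_mono k) b) (loop_elt y (t_mono r) b')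
    = loop_elt (lie x y) (t_mono (k + r)) (b * b')
      + z_elt (form x y *\<^sub>C (\<Sum>i\<in>UNIV. of_int (k $ i) *\<^sub>C tK (k + r) i)) (b * b')"
proof -
  have split: "(p, z) \<otimes>\<^sub>C c = (p, 0) \<otimes>\<^sub>C c + (0, z) \<otimes>\<^sub>C c"
    for p :: "('a, 'n laurent) tensor" and z :: "'n zspace" and c :: 'b
    using cbilinearD(1)[OF cbilinear_pure_tensor, of "(p, 0)" "(0, z)" c] by simp
  show ?thesis
    unfolding loop_elt_def z_elt_def tau_bracket_generators[OF bilinear_form[OF assms]]
      tau0_bracket_mono[OF assms]
    by (subst split) simp
qed

lemma tau_bracket_tau0_z:
  fixes S :: "('g::complex_lie_algebra, 'n::finite) tau0" and b b' :: "'b::complex_comm_algebra"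
  assumes "invariant_form form"
  shows "tau_bracket form (S \<otimes>\<^sub>C b, 0) (z_elt z b') = 0"
proof -
  have "tau0_bracket form S (0, z) = tau0_bracket form S 0"
    by (simp add: tau0_bracket_def)
  also have "\<dots> = 0"
    using tau0_bracket_linear(4)[OF assms, of S 0 0] by simp
  finally show ?thesis
    unfolding z_elt_def tau_bracket_generators[OF bilinear_form[OF assms]]
    by (simp add: pure_tensor_0 flip: zero_prod_def)
qed

lemma tau_bracket_D_z:
  fixes b :: "'b::complex_comm_algebra"
  assumes "invariant_form form"
  shows "tau_bracket form (0, c) (z_elt (tK k i) b) = degree_val c k *\<^sub>C z_elt (tK k i) b"
proof -
  have *: "tau0_deriv c (0, tK k i) = degree_val c k *\<^sub>C (0, tK k i)"
    using tau0_deriv_pure[of c 0 0 "tK k i"]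
    by (simp add: pure_tensor_0 clinearD[OF clinear_laurent_deriv] zspace_deriv_tK scaleC_prod_def)
  show ?thesis
    unfolding z_elt_def tau_bracket_generators[OF bilinear_form[OF assms]] * cbilinearD[OF cbilinear_pure_tensor]
    by (simp add: scaleC_prod_def)
qed

lemma tau_bracket_D_loop:
  fixes b :: "'b::complex_comm_algebra"
  assumes "invariant_form form"
  shows "tau_bracket form (d_elt i) (loop_elt x (t_mono k) b) = of_int (k $ i) *\<^sub>C loop_elt x (t_mono k) b"
proof -
  have "degree_val (axis i 1) k = of_int (k $ i)"
    by (simp add: degree_val_def axis_def if_distrib[of "\<lambda>x. x * _"] cong: if_cong)
  then have *: "tau0_deriv (axis i 1) (x \<otimes>\<^sub>C t_mono k, 0) = of_int (k $ i) *\<^sub>C (x \<otimes>\<^sub>C t_mono k, 0)"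
    by (simp add: tau0_deriv_mono[OF assms] clinearD[OF clinear_zspace_deriv] scaleC_prod_def)
  show ?thesis
    unfolding d_elt_def loop_elt_def tau_bracket_generators[OF bilinear_form[OF assms]] * cbilinearD[OF cbilinear_pure_tensor]
    by (simp add: scaleC_prod_def)
qed

lemma zspace_span_tK: "z \<in> cvs.span {tK k i | k i. True}"
proof -
  obtain u where u: "z = abs_zspace u"
    using Quotient3_abs_rep[OF Quotient3_zspace] by metis
  have "abs_zspace (\<Sum>p\<in>I. c p *\<^sub>C Poly_Mapping.single p 1) \<in> cvs.span {tK k i | k i. True}"
    if "finite I" for I and c :: "'a expo \<times> 'a option \<Rightarrow> complex"
    using that
  proof induction
    case empty
    show ?case by (simp add: cvs.span_zero flip: zero_zspace.abs_eq)
  next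
    case (insert p I)
    have "abs_zspace (c p *\<^sub>C Poly_Mapping.single p 1) = c p *\<^sub>C tK (fst p) (snd p)"
      by (simp add: tK.abs_eq flip: scaleC_zspace.abs_eq)
    then have "abs_zspace (c p *\<^sub>C Poly_Mapping.single p 1) \<in> cvs.span {tK k i | k i. True}"
      by (simp only:) (intro cvs.span_scale cvs.span_base, blast)
    with insert show ?case
      by (auto simp flip: plus_zspace.abs_eq intro: cvs.span_add)
  qed
  from this[of "Poly_Mapping.keys u" "Poly_Mapping.lookup u"] show ?thesis
    unfolding u by (subst poly_mapping_expansion) simp
qed

locale level_zero_module =
  fixes form :: "'g::complex_lie_algebra \<Rightarrow> 'g \<Rightarrow> complex"
    and \<rho> :: "('g, 'n::finite, 'b::complex_comm_algebra) tau \<Rightarrow> 'v::complex_vector \<Rightarrow> 'v"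
  assumes inv: "invariant_form form" and module: "tau_module form \<rho>"
    and level_zero: "acts_trivially (range K_elt) \<rho>"
begin

definition loop_op :: "'g \<Rightarrow> 'n expo \<Rightarrow> 'b \<Rightarrow> 'v \<Rightarrow> 'v" where
  "loop_op x k b = \<rho> (loop_elt x (t_mono k) b)"

definition central_op :: "'n expo \<Rightarrow> 'n option \<Rightarrow> 'b \<Rightarrow> 'v \<Rightarrow> 'v" where
  "central_op k i b = \<rho> (z_elt (tK k i) b)"

lemma \<rho>_bilinear: "cbilinear \<rho>"
  using module by (simp add: tau_module_def)

lemma \<rho>_bracket: "\<rho> X (\<rho> Y v) = \<rho> Y (\<rho> X v) + \<rho> (tau_bracket form X Y) v"
proof -
  have "\<rho> (tau_bracket form X Y) v = \<rho> X (\<rho> Y v) - \<rho> Y (\<rho> X v)"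
    using module unfolding tau_module_def by blast
  then show ?thesis by simp
qed

lemma \<rho>_linear: "clinear (\<rho> X)" "clinear (\<lambda>X. \<rho> X v)"
  using \<rho>_bilinear unfolding cbilinear_def by blast+

lemmas \<rho>_lin = clinearD[OF \<rho>_linear(1)] clinearD[OF \<rho>_linear(2)]

lemma loop_op_linear: "clinear (loop_op x k b)"
  by (simp add: loop_op_def \<rho>_linear)

lemma central_op_linear: "clinear (central_op k i b)"
  by (simp add: central_op_def \<rho>_linear)

lemma loop_op_scale: "loop_op (c *\<^sub>C x) k b v = c *\<^sub>C loop_op x k b v"
proof -
  have "loop_elt (c *\<^sub>C x) (t_mono k) b = c *\<^sub>C loop_elt x (t_mono k) b"
    using cbilinearD(3)[OF cbilinear_pure_tensor, of c "(x \<otimes>\<^sub>C t_mono k, 0)" b]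
    by (simp add: loop_elt_def scaleC_prod_def cbilinearD[OF cbilinear_pure_tensor])
  then show ?thesis by (simp add: loop_op_def \<rho>_lin)
qed

lemma z_elt_linear: "clinear (\<lambda>z. \<rho> (z_elt z b) v)"
proof -
  have "z_elt (z + z') b = z_elt z b + (z_elt z' b :: ('g, 'n, 'b) tau)"
    "z_elt (c *\<^sub>C z) b = c *\<^sub>C (z_elt z b :: ('g, 'n, 'b) tau)" for z z' c
    using cbilinearD(1)[OF cbilinear_pure_tensor, of "(0, z)" "(0, z')" b]
      cbilinearD(3)[OF cbilinear_pure_tensor, of c "(0, z)" b]
    by (simp_all add: z_elt_def scaleC_prod_def)
  then show ?thesis by (simp add: clinear_iff \<rho>_lin)
qed

lemma loop_op_commute:
  "loop_op x k b (loop_op y r b' v) = loop_op y r b' (loop_op x k b v)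
    + loop_op (lie x y) (k + r) (b * b') v
    + form x y *\<^sub>C (\<Sum>i\<in>UNIV. of_int (k $ i) *\<^sub>C central_op (k + r) i (b * b') v)"
proof -
  interpret z: Vector_Spaces.linear scaleC scaleC "\<lambda>z. \<rho> (z_elt z (b * b')) v"
    by (rule z_elt_linear)
  show ?thesis
    unfolding loop_op_def \<rho>_bracket[of "loop_elt x (t_mono k) b"] tau_bracket_loop_loop[OF inv]
    by (simp add: \<rho>_lin z.scale z.sum central_op_def add.assoc)
qed

lemma central_op_loop_op:
  "central_op k i b (loop_op x r b' v) = loop_op x r b' (central_op k i b v)"
  using \<rho>_bracket[of "loop_elt x (t_mono r) b'" "z_elt (tK k i) b" v]
  by (simp add: central_op_def loop_op_def loop_elt_def tau_bracket_tau0_z[OF inv] \<rho>_lin)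

lemma central_op_level_zero: "central_op 0 i 1 v = 0"
  using level_zero by (simp add: central_op_def acts_trivially_def K_elt_def)

lemma loop_op_commute_level_zero:
  "loop_op x k 1 (loop_op y (- k) 1 v) = loop_op y (- k) 1 (loop_op x k 1 v) + loop_op (lie x y) 0 1 v"
  by (simp add: loop_op_commute[of x k 1 y "- k"] central_op_level_zero)

lemma loop_op_constant_commute:
  "loop_op x 0 1 (loop_op y k b v) = loop_op y k b (loop_op x 0 1 v) + loop_op (lie x y) k b v"
  by (simp add: loop_op_commute[of x 0 1 y k])

text \<open>The operator commutes with \<open>\<tau>\<^sub>0 \<otimes> B\<close>, and commuting it with an element of
  \<open>D\<close> only yields a multiple of itself.\<close>

lemma submodule_kernel_central_op: "submodule \<rho> {v. central_op k i b v = 0}"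
  unfolding submodule_def
proof (intro conjI allI ballI)
  let ?W = "{v. central_op k i b v = 0}"
  interpret C: Vector_Spaces.linear scaleC scaleC "central_op k i b"
    by (rule central_op_linear)
  show W: "cvs.subspace ?W" by (rule C.subspace_kernel)
  fix X w assume w: "w \<in> ?W"
  show "\<rho> X w \<in> ?W"
  proof (induction X rule: tau_induct)
    case (tau0 S b')
    show ?case
      using w \<rho>_bracket[of "(S \<otimes>\<^sub>C b', 0)" "z_elt (tK k i) b" w]
      by (simp add: central_op_def tau_bracket_tau0_z[OF inv] \<rho>_lin)
  next
    case (D c)
    show ?case
      using w \<rho>_bracket[of "(0, c)" "z_elt (tK k i) b" w]
      by (simp add: central_op_def tau_bracket_D_z[OF inv] \<rho>_lin)
  next
    case (add X Y)
    then show ?case by (simp add: \<rho>_lin C.add)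
  qed
qed

lemma central_op_zero_if_nilpotent_on_vector:
  assumes irr: "irreducible_module \<rho>" and "v \<noteq> 0" and "(central_op k i b ^^ r) v = 0"
  shows "central_op k i b w = 0"
proof -
  have "\<exists>u. u \<noteq> 0 \<and> central_op k i b u = 0"
    using assms(2,3)
  proof (induction r arbitrary: v)
    case (Suc r)
    show ?case
    proof (cases "central_op k i b v = 0")
      case False
      then show ?thesis
        using Suc.IH[OF False] Suc.prems(2) by (simp add: funpow_Suc_right del: funpow.simps)
    qed (use Suc.prems in blast)
  qed simp
  then have "{v. central_op k i b v = 0} \<noteq> {0}" by blast
  then have "{v. central_op k i b v = 0} = UNIV"
    using irr submodule_kernel_central_op[of k i b] unfolding irreducible_module_def by blast
  then show ?thesis by blast
qed

lemma Z_tensor_B_trivial: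
  assumes "\<And>k i b v. central_op k i b v = 0"
  shows "acts_trivially Z_tensor_B \<rho>"
proof -
  have z: "\<rho> (z_elt z b) v = 0" for z b v
  proof -
    interpret z: Vector_Spaces.linear scaleC scaleC "\<lambda>z. \<rho> (z_elt z b) v"
      by (rule z_elt_linear)
    show ?thesis
      using zspace_span_tK[of z]
    proof (induction rule: cvs.span_induct)
      case base
      then show ?case by (rule z.subspace_kernel)
    next
      case (step z)
      then show ?case using assms by (auto simp: central_op_def)
    qed
  qed
  have "\<rho> X v = 0" if "X \<in> Z_tensor_B" for X v
    using that unfolding Z_tensor_B_def
  proof (induction rule: cvs.span_induct)
    case base
    interpret Vector_Spaces.linear scaleC scaleC "\<lambda>X. \<rho> X v"
      by (rule \<rho>_linear)
    show ?case by (rule subspace_kernel)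
  next
    case (step X)
    then show ?case using z by auto
  qed
  then show ?thesis by (simp add: acts_trivially_def)
qed

text \<open>Weight spaces described by the eigenvalues of the spanning elements of \<open>H\<close>, so that a shift of the weight
  by \<open>\<beta> + \<delta>\<^sub>m\<close> can be written down without first constructing it as a functional on
  \<open>H\<close>.\<close>

definition weight_vectors :: "'g set \<Rightarrow> ('g \<Rightarrow> complex) \<Rightarrow> ('n option \<Rightarrow> complex) \<Rightarrow> 'v set" where
  "weight_vectors h a c = {v. (\<forall>z\<in>h. loop_op z 0 1 v = a z *\<^sub>C v) \<and> (\<forall>i. \<rho> (d_elt i) v = c i *\<^sub>C v)}"

lemma subspace_weight_vectors: "cvs.subspace (weight_vectors h a c)"
  unfolding cvs.subspace_def weight_vectors_def
  by (auto simp: clinearD[OF loop_op_linear] \<rho>_lin scaleC_add_right mult.commute)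

text \<open>If the space is nonzero, then every element of \<open>H\<close> acts on it by a scalar, since this holds for the
  spanning elements.  The scalars depend linearly on the element, so the space lies in a weight space in the strict sense.\<close>

lemma finite_dim_weight_vectors:
  assumes fd: "\<And>\<mu>. \<mu> \<in> cdual (tau_H h) \<Longrightarrow> finite_dimC (weight_space \<rho> (tau_H h) \<mu>)"
  shows "finite_dimC (weight_vectors h a c)"
proof (cases "weight_vectors h a c \<subseteq> {0}")
  case True
  then show ?thesis by (auto simp: finite_dimC_def intro!: exI[of _ "{}"])
next
  case False
  then obtain v where v: "v \<in> weight_vectors h a c" "v \<noteq> 0" by blast
  let ?S = "{X. \<exists>l. \<forall>w\<in>weight_vectors h a c. \<rho> X w = l *\<^sub>C w}"
  have "cvs.subspace ?S"
    unfolding cvs.subspace_def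
  proof (intro conjI ballI allI; clarify)
    show "\<exists>l. \<forall>w\<in>weight_vectors h a c. \<rho> 0 w = l *\<^sub>C w"
      by (intro exI[of _ 0]) (simp add: \<rho>_lin)
  next
    fix X Y l l' assume "\<forall>w\<in>weight_vectors h a c. \<rho> X w = l *\<^sub>C w" "\<forall>w\<in>weight_vectors h a c. \<rho> Y w = l' *\<^sub>C w"
    then show "\<exists>l. \<forall>w\<in>weight_vectors h a c. \<rho> (X + Y) w = l *\<^sub>C w"
      by (intro exI[of _ "l + l'"]) (simp add: \<rho>_lin scaleC_add_left)
  next
    fix d X l assume "\<forall>w\<in>weight_vectors h a c. \<rho> X w = l *\<^sub>C w"
    then show "\<exists>l. \<forall>w\<in>weight_vectors h a c. \<rho> (d *\<^sub>C X) w = l *\<^sub>C w"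
      by (intro exI[of _ "d * l"]) (simp add: \<rho>_lin)
  qed
  moreover have "(\<lambda>x. loop_elt x (t_mono 0) 1) ` h \<union> range K_elt \<union> range d_elt \<subseteq> ?S"
  proof -
    have "K_elt i \<in> ?S" for i
      using level_zero by (auto simp: acts_trivially_def intro!: exI[of _ 0])
    then show ?thesis
      by (auto simp: weight_vectors_def loop_op_def)
  qed
  ultimately have H: "tau_H h \<subseteq> ?S"
    unfolding tau_H_def by (intro cvs.span_minimal)
  define \<mu> where "\<mu> X = (if X \<in> tau_H h then SOME l. \<forall>w\<in>weight_vectors h a c. \<rho> X w = l *\<^sub>C w else undefined)" for X
  have \<mu>: "\<rho> X w = \<mu> X *\<^sub>C w" if "X \<in> tau_H h" "w \<in> weight_vectors h a c" for X w
  proof -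
    have ex: "\<exists>l. \<forall>w\<in>weight_vectors h a c. \<rho> X w = l *\<^sub>C w"
      using H that by blast
    have "\<mu> X = (SOME l. \<forall>w\<in>weight_vectors h a c. \<rho> X w = l *\<^sub>C w)"
      using that(1) unfolding \<mu>_def by (rule if_P)
    then show ?thesis
      using someI_ex[OF ex] that(2) by (elim ssubst) blast
  qed
  have sub: "cvs.subspace (tau_H h :: ('g, 'n, 'b) tau set)"
    by (simp add: tau_H_def)
  have "\<mu> \<in> cdual (tau_H h)"
    unfolding cdual_def
  proof (intro CollectI conjI ballI allI)
    show "\<mu> \<in> extensional (tau_H h)"
      by (simp add: extensional_def \<mu>_def)
  next
    fix X Y :: "('g, 'n, 'b) tau" assume "X \<in> tau_H h" "Y \<in> tau_H h"
    then have "\<mu> (X + Y) *\<^sub>C v = (\<mu> X + \<mu> Y) *\<^sub>C v"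
      using \<mu>[OF _ v(1)] cvs.subspace_add[OF sub, of X Y] by (simp add: scaleC_add_left \<rho>_lin flip: \<mu>[OF _ v(1)])
    then show "\<mu> (X + Y) = \<mu> X + \<mu> Y" using v(2) by simp
  next
    fix d and X :: "('g, 'n, 'b) tau" assume "X \<in> tau_H h"
    then have "\<mu> (d *\<^sub>C X) *\<^sub>C v = (d * \<mu> X) *\<^sub>C v"
      using \<mu>[OF _ v(1)] cvs.subspace_scale[OF sub, of X d] by (simp add: \<rho>_lin flip: scaleC_scaleC \<mu>[OF _ v(1)])
    then show "\<mu> (d *\<^sub>C X) = d * \<mu> X" using v(2) by simp
  qed
  from fd[OF this] obtain B where "finite B" "weight_space \<rho> (tau_H h) \<mu> \<subseteq> cvs.span B"
    by (auto simp: finite_dimC_def)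
  moreover have "weight_vectors h a c \<subseteq> weight_space \<rho> (tau_H h) \<mu>"
    using \<mu> by (auto simp: weight_space_def)
  ultimately show ?thesis
    unfolding finite_dimC_def by blast
qed

lemma loop_op_weight_vectors:
  assumes "v \<in> weight_vectors h a c" and "\<And>z. z \<in> h \<Longrightarrow> lie z x = \<beta> z *\<^sub>C x"
  shows "loop_op x k b v \<in> weight_vectors h (\<lambda>z. a z + \<beta> z) (\<lambda>i. c i + of_int (k $ i))"
proof -
  have "loop_op z 0 1 (loop_op x k b v) = (a z + \<beta> z) *\<^sub>C loop_op x k b v" if "z \<in> h" for z
    using assms that unfolding weight_vectors_def
    by (simp add: loop_op_constant_commute loop_op_scale clinearD[OF loop_op_linear] scaleC_add_left)
  moreover have "\<rho> (d_elt i) (loop_op x k b v) = (c i + of_int (k $ i)) *\<^sub>C loop_op x k b v" for i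
    using assms unfolding weight_vectors_def
    by (simp add: loop_op_def \<rho>_bracket[of "d_elt i"] tau_bracket_D_loop[OF inv] \<rho>_lin scaleC_add_left)
  ultimately show ?thesis
    by (simp add: weight_vectors_def)
qed

end

section \<open>Vectors of extremal weight\<close>

text \<open>
  Only data invariant under \<open>(e, f, t, \<theta>) \<mapsto> (f, e, -t, -\<theta>)\<close> are assumed, so that the sign of the root can be chosen to suit a given
  weight.
\<close>

locale root_triple_module = level_zero_module form \<rho>
  for form :: "'g::complex_lie_algebra \<Rightarrow> 'g \<Rightarrow> complex"
    and \<rho> :: "('g, 'n::finite, 'b::complex_comm_algebra) tau \<Rightarrow> 'v::complex_vector \<Rightarrow> 'v" +
  fixes h :: "'g set" and \<theta> :: "'g \<Rightarrow> complex" and e f t :: 'g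
  assumes t_h: "t \<in> h" and lie_e_f: "lie e f = t" and form_e_f: "form e f = 1" and \<theta>_t: "\<theta> t = 2"
    and lie_h_e: "\<And>z. z \<in> h \<Longrightarrow> lie z e = \<theta> z *\<^sub>C e"
    and lie_h_f: "\<And>z. z \<in> h \<Longrightarrow> lie z f = (- \<theta> z) *\<^sub>C f"
    and e_nilpotent: "\<And>m b v. \<exists>k. (loop_op e m b ^^ k) v = 0"
    and f_nilpotent: "\<And>m b v. \<exists>k. (loop_op f m b ^^ k) v = 0"
    and finite_dim: "\<And>a c. finite_dimC (weight_vectors h a c)"
begin

lemma lie_t: "lie t e = 2 *\<^sub>C e" "lie t f = (-2) *\<^sub>C f" "lie e t = (-2) *\<^sub>C e"
  using lie_h_e[OF t_h] lie_h_f[OF t_h] lie_antisym[OF inv, of e t] by (simp_all add: \<theta>_t)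

lemma form_t: "form t f = 0" "form e t = 0"
proof -
  note bil = cbilinearD[OF bilinear_form[OF inv]]
  show "form t f = 0"
    using form_inv[OF inv, of e f f] bil(4)[of e 0 0] by (simp add: lie_e_f lie_self)
  show "form e t = 0"
    using form_inv[OF inv, of e e f] bil(3)[of 0 0 f] by (simp add: lie_e_f lie_self)
qed

text \<open>At level zero the Cartan element of the triple does not depend on \<open>k\<close>.\<close>

lemma sl2_triple_loop: "sl2_triple (loop_op e (- k) 1) (loop_op f k 1) (loop_op t 0 1)"
proof (rule sl2_triple.intro)
  show "loop_op e (- k) 1 (loop_op f k 1 v) = loop_op f k 1 (loop_op e (- k) 1 v) + loop_op t 0 1 v" for v
    using loop_op_commute_level_zero[of e "- k" f v] by (simp add: lie_e_f)
  show "loop_op t 0 1 (loop_op e (- k) 1 v) = loop_op e (- k) 1 (loop_op t 0 1 v) + 2 *\<^sub>C loop_op e (- k) 1 v" for v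
    by (simp add: loop_op_constant_commute lie_t loop_op_scale)
  show "loop_op t 0 1 (loop_op f k 1 v) = loop_op f k 1 (loop_op t 0 1 v) - 2 *\<^sub>C loop_op f k 1 v" for v
    unfolding loop_op_constant_commute[of t f] lie_t loop_op_scale by simp
qed (rule loop_op_linear e_nilpotent f_nilpotent)+

text \<open>The assumption on \<open>Re (a t)\<close> ensures that \<open>f\<close> and \<open>e f\<close> are injective on every
  weight space strictly above the given one in the direction of \<open>\<theta>\<close>.\<close>

lemma singular_vector_exists:
  assumes v0: "v0 \<in> weight_vectors h a c" "v0 \<noteq> 0" and Re: "Re (a t) \<ge> 0"
  obtains v N where "v \<noteq> 0" and "loop_op t 0 1 v = N *\<^sub>C v" and "\<And>k b. loop_op e k b v = 0"
proof -
  define U where "U j m = weight_vectors h (\<lambda>z. a z + of_nat j * \<theta> z) (\<lambda>i. c i + of_int (m $ i))"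
    for j :: nat and m :: "'n expo"
  have eU: "loop_op e k b v \<in> U (Suc j) (m + k)" if "v \<in> U j m" for v j m k b
    using loop_op_weight_vectors[OF that[unfolded U_def] lie_h_e, of k b]
    by (simp add: U_def algebra_simps)
  have fU: "loop_op f k b v \<in> U j (m + k)" if "v \<in> U (Suc j) m" for v j m k b
    using loop_op_weight_vectors[OF that[unfolded U_def] lie_h_f, of k b]
    by (simp add: U_def algebra_simps)
  have tU: "loop_op t 0 1 v = (a t + 2 * of_nat j) *\<^sub>C v" if "v \<in> U j m" for v j m
    using that t_h by (simp add: U_def weight_vectors_def \<theta>_t mult.commute)
  have f_nonzero: "loop_op f k 1 v \<noteq> 0" "loop_op e (- k) 1 (loop_op f k 1 v) \<noteq> 0"
    if "v \<in> U (Suc j) m" "v \<noteq> 0" for v j m k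
    using sl2_triple.F_nonzero[OF sl2_triple_loop tU[OF that(1)] that(2)]
      sl2_triple.E_F_nonzero[OF sl2_triple_loop tU[OF that(1)] that(2)] Re by auto
  have U_sub: "cvs.subspace (U j m)" and U_fd: "finite_dimC (U j m)" for j m
    unfolding U_def by (rule subspace_weight_vectors, rule finite_dim)
  \<comment> \<open>Finite dimensionality bounds the weights on the line \<open>\<lambda> + j\<theta>\<close>.\<close>
  have "\<exists>j. U j 0 = {0}"
  proof (rule ccontr)
    assume not: "\<not> ?thesis"
    note onto = injective_onto_if_dim_not_smaller[OF U_sub U_sub U_fd U_fd loop_op_linear[of f 0 1]]
    have into: "loop_op f 0 1 v \<in> U j 0" if "v \<in> U (Suc j) 0" for v j
      using fU[OF that, of 0 1] by simp
    have inj: "v = 0" if "v \<in> U (Suc j) 0" "loop_op f 0 1 v = 0" for v j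
      using f_nonzero(1)[OF that(1)] that(2) by blast
    obtain J where J: "\<And>j. cvs.dim (U J 0) \<le> cvs.dim (U j 0)"
      using ex_has_least_nat[of "\<lambda>_. True" undefined "\<lambda>j. cvs.dim (U j 0)"] by auto
    have dim_le: "cvs.dim (U (J + i) 0) \<le> cvs.dim (U J 0)" for i
    proof (induction i)
      case (Suc i)
      have "cvs.dim (U (Suc (J + i)) 0) \<le> cvs.dim (U (J + i) 0)"
        by (rule onto(1)[OF into inj])
      with Suc show ?case by simp
    qed simp
    have e_inj: "loop_op e 0 1 v \<noteq> 0" if v: "v \<in> U (J + i) 0" "v \<noteq> 0" for v i
    proof -
      have "loop_op f 0 1 ` U (Suc (J + i)) 0 = U (J + i) 0"
        by (rule onto(2)[OF into inj order_trans[OF dim_le J]])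
      then obtain w where w: "w \<in> U (Suc (J + i)) 0" "v = loop_op f 0 1 w"
        using v(1) by blast
      moreover have "w \<noteq> 0"
        using w(2) v(2) clinearD(3)[OF loop_op_linear] by auto
      ultimately show ?thesis
        using f_nonzero(2)[of w "J + i" 0 0] by simp
    qed
    have "0 \<in> U J 0" by (rule cvs.subspace_0[OF U_sub])
    then obtain v where v: "v \<in> U J 0" "v \<noteq> 0" using not by blast
    have "(loop_op e 0 1 ^^ i) v \<in> U (J + i) 0 \<and> (loop_op e 0 1 ^^ i) v \<noteq> 0" for i
    proof (induction i)
      case (Suc i)
      then show ?case
        using eU[of "(loop_op e 0 1 ^^ i) v" "J + i" 0 0 1] e_inj[of "(loop_op e 0 1 ^^ i) v" i] by simp
    qed (use v in simp)
    then show False using e_nilpotent[of 0 1 v] by blast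
  qed
  then obtain J where J: "U J 0 = {0}" and least: "\<And>j. j < J \<Longrightarrow> U j 0 \<noteq> {0}"
    using LeastI_ex[of "\<lambda>j. U j 0 = {0}"] not_less_Least[of _ "\<lambda>j. U j 0 = {0}"] by metis
  have U0: "U 0 0 = weight_vectors h a c"
    by (simp add: U_def)
  with J v0 have "J \<noteq> 0" by (metis singletonD)
  then obtain j where j: "J = Suc j" by (cases J) auto
  \<comment> \<open>The bound on one line bounds all its translates by \<open>\<delta>\<^sub>m\<close>, at the cost of one more step.\<close>
  have above: "v = 0" if "v \<in> U (Suc J) m" for v m
    using fU[OF that, of "- m" 1] f_nonzero(1)[OF that, of "- m"] J by auto
  have "\<exists>v j m. v \<noteq> 0 \<and> v \<in> U j m \<and> (\<forall>k b. loop_op e k b v = 0)"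
  \<comment> \<open>A translate of the line may reach height \<open>J\<close>, but none can go higher.\<close>
  proof (cases "\<exists>m. \<exists>v\<in>U J m. v \<noteq> 0")
    case True
    then show ?thesis using eU above by blast
  next
    case False
    have "0 \<in> U j 0" by (rule cvs.subspace_0[OF U_sub])
    then obtain v where "v \<in> U j 0" "v \<noteq> 0" using least[of j] j by blast
    then show ?thesis using eU False j by blast
  qed
  then show thesis using that tU by blast
qed

section \<open>Nilpotency of the central operators\<close>

text \<open>All \<open>F\<^sub>s\<^sub>,\<^sub>0 = f \<otimes> t\<^sup>k\<^sup>-\<^sup>p\<close> belong to sl2-triples with Cartan
  element \<open>t\<close>, so one power of them kills \<open>v\<close> for all \<open>s\<close> at once.\<close>

lemma central_op_nilpotent_on_singular:
  assumes v: "v \<noteq> 0" "loop_op t 0 1 v = N *\<^sub>C v" and singular: "\<And>k b. loop_op e k b v = 0"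
  shows "\<exists>r. (central_op k i b ^^ r) v = 0"
proof -
  let ?p = "\<lambda>s. axis i (int s) :: 'n expo"
  define E where "E s = loop_op e (?p s) b" for s
  define F where "F s j = loop_op f (int (Suc j) *s k - ?p s) (b ^ j)" for s j
  define H where "H j = loop_op t (int j *s k) (b ^ j)" for j
  define Z where "Z j = central_op (int j *s k) i (b ^ j)" for j
  define S where "S = {u. \<forall>k b. loop_op e k b u = 0}"
  interpret lowering_family E F H Z S
  proof (rule lowering_family.intro)
    fix s j a v u
    have "(\<Sum>l\<in>UNIV. of_int (?p s $ l) *\<^sub>C central_op (int (Suc j) *s k) l (b ^ Suc j) v)
        = of_nat s *\<^sub>C Z (Suc j) v"
    proof -
      have "of_int (?p s $ l) *\<^sub>C central_op (int (Suc j) *s k) l (b ^ Suc j) v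
          = (if l = i then of_nat s *\<^sub>C Z (Suc j) v else 0)" for l
        by (simp add: axis_def Z_def)
      then show ?thesis by (simp add: sum.delta)
    qed
    then show "E s (F s j v) = F s j (E s v) + H (Suc j) v + of_nat s *\<^sub>C Z (Suc j) v"
      unfolding E_def F_def loop_op_commute[of e] lie_e_f form_e_f H_def by (simp add: scaleC_one)
    have eq: "int a *s k + (int (Suc j) *s k - ?p s) = int (Suc (a + j)) *s k - ?p s"
      by (simp add: vec_eq_iff algebra_simps)
    show "H a (F s j v) = F s j (H a v) - 2 *\<^sub>C F s (a + j) v"
      unfolding H_def F_def loop_op_commute[of t] lie_t form_t loop_op_scale eq power_add
      by simp
    show "Z a (F s j v) = F s j (Z a v)"
      by (simp add: Z_def F_def central_op_loop_op)
    assume u: "u \<in> S"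
    then show "E s u = 0" by (simp add: S_def E_def)
    show "H a u \<in> S"
      using u unfolding S_def H_def mem_Collect_eq loop_op_commute[of e] lie_t form_t loop_op_scale
      by (simp add: clinearD[OF loop_op_linear])
    show "Z a u \<in> S"
      using u by (simp add: S_def Z_def clinearD[OF central_op_linear] flip: central_op_loop_op)
  qed (simp_all add: E_def F_def H_def Z_def loop_op_linear central_op_linear)
  have "\<exists>r. N = of_nat r \<and> (F s 0 ^^ Suc r) v = 0" for s
    using sl2_triple.F_power_highest[OF sl2_triple_loop v(2,1) singular, of "k - ?p s"]
    by (simp add: F_def)
  then obtain r where "\<And>s. (F s 0 ^^ Suc r) v = 0"
    by (metis of_nat_eq_iff)
  then have "(Z 1 ^^ Suc r) v = 0"
    using singular by (intro Z_nilpotent) (simp_all add: S_def)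
  then show ?thesis
    by (intro exI[of _ "Suc r"]) (simp add: Z_def)
qed

lemma Z_tensor_B_trivial_if_dominant:
  assumes "irreducible_module \<rho>" and "v0 \<in> weight_vectors h a c" "v0 \<noteq> 0" and "Re (a t) \<ge> 0"
  shows "acts_trivially Z_tensor_B \<rho>"
proof -
  obtain v N where v: "v \<noteq> 0" "loop_op t 0 1 v = N *\<^sub>C v" "\<And>k b. loop_op e k b v = 0"
    using singular_vector_exists[OF assms(2-4)] by blast
  have "central_op k i b w = 0" for k i b w
    using central_op_nilpotent_on_singular[OF v, of k i b]
      central_op_zero_if_nilpotent_on_vector[OF assms(1) v(1)] by blast
  then show ?thesis by (rule Z_tensor_B_trivial)
qed

end

lemma weight_vector_exists:
  fixes \<rho> :: "('g::complex_lie_algebra, 'n::finite, 'b::complex_comm_algebra) tau \<Rightarrow> 'v::complex_vector \<Rightarrow> 'v"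
  assumes "irreducible_module \<rho>" and "integrable_module h \<rho>"
  obtains \<mu> v where "v \<in> weight_space \<rho> (tau_H h) \<mu>" "v \<noteq> 0"
proof -
  obtain v0 :: 'v where "v0 \<noteq> 0"
    using assms(1) by (auto simp: irreducible_module_def)
  have "\<exists>w. Poly_Mapping.keys w \<subseteq> cdual (tau_H h)
      \<and> (\<forall>\<mu>\<in>cdual (tau_H h). Poly_Mapping.lookup w \<mu> \<in> weight_space \<rho> (tau_H h) \<mu>)
      \<and> v0 = (\<Sum>\<mu>\<in>Poly_Mapping.keys w. Poly_Mapping.lookup w \<mu>)"
    using assms(2) unfolding integrable_module_def internal_direct_sum_def by (blast dest: ex1_implies_ex)
  then obtain w where w: "Poly_Mapping.keys w \<subseteq> cdual (tau_H h)"
      "\<forall>\<mu>\<in>cdual (tau_H h). Poly_Mapping.lookup w \<mu> \<in> weight_space \<rho> (tau_H h) \<mu>"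
      "v0 = (\<Sum>\<mu>\<in>Poly_Mapping.keys w. Poly_Mapping.lookup w \<mu>)"
    by blast
  with \<open>v0 \<noteq> 0\<close> have "Poly_Mapping.keys w \<noteq> {}" by auto
  then obtain \<mu> where "\<mu> \<in> Poly_Mapping.keys w" by blast
  with w that[of "Poly_Mapping.lookup w \<mu>" \<mu>] show thesis
    by (auto simp: in_keys_iff)
qed

theorem proposition6p2:
  fixes h :: "'g::complex_lie_algebra set"
    and form :: "'g \<Rightarrow> 'g \<Rightarrow> complex"
    and \<rho> :: "('g, 'n::finite, 'b::complex_comm_algebra) tau \<Rightarrow> 'v::complex_vector \<Rightarrow> 'v"
  assumes "simple_lie_algebra TYPE('g)" and "finite_dimC (UNIV :: 'g set)"
    and "cartan_subalgebra h" and "normalized_form h form"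
    and "finitely_generated_algebra TYPE('b)"
    and "tau_module form \<rho>"
    and "\<not> acts_trivially UNIV \<rho>"
    and "irreducible_module \<rho>"
    and "integrable_module h \<rho>"
    and "\<And>\<mu>. \<mu> \<in> cdual (tau_H h) \<Longrightarrow> finite_dimC (weight_space \<rho> (tau_H h) \<mu>)"
    and "acts_trivially (range K_elt) \<rho>"
  shows "acts_trivially Z_tensor_B \<rho>"
proof -
  interpret level_zero_module form \<rho>
    using assms(4,6,11) by unfold_locales (simp_all add: normalized_form_def)
  obtain \<theta> e f t where \<theta>: "\<theta> \<in> roots h" and e: "e \<in> root_space h \<theta>"
    and f: "\<And>z. z \<in> h \<Longrightarrow> lie z f = (- \<theta> z) *\<^sub>C f" "f \<noteq> 0"
    and t: "t \<in> h" "lie e f = t" "form e f = 1" "\<theta> t = 2"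
    by (rule root_triple_exists[OF assms(2-4)]) (rule that)
  have e': "lie z e = \<theta> z *\<^sub>C e" if "z \<in> h" for z
    using e that by (simp add: root_space_def)
  \<comment> \<open>The functional \<open>-\<theta>\<close>, made \<open>undefined\<close> outside \<open>h\<close> to be an element of \<open>cdual h\<close>.\<close>
  define \<theta>' where "\<theta>' z = (if z \<in> h then - \<theta> z else undefined)" for z
  have f_root: "f \<in> root_space h \<theta>'"
    using f(1) by (simp add: root_space_def \<theta>'_def)
  have sub: "cvs.subspace h"
    using assms(3) by (simp add: cartan_subalgebra_def)
  have "\<theta>' \<in> cdual h"
    using \<theta> unfolding roots_def cdual_def extensional_def
    by (auto simp: \<theta>'_def cvs.subspace_add[OF sub] cvs.subspace_scale[OF sub])
  then have \<theta>': "\<theta>' \<in> roots h"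
  proof -
    have "\<theta>' t \<noteq> 0"
      using t(1,4) by (simp add: \<theta>'_def)
    with \<open>\<theta>' \<in> cdual h\<close> f_root f(2) t(1) show ?thesis
      unfolding roots_def by blast
  qed
  have nilpotent: "\<exists>k. (loop_op x m b ^^ k) v = 0" if "\<alpha> \<in> roots h" "x \<in> root_space h \<alpha>" for x \<alpha> m b v
    using assms(9) that unfolding integrable_module_def loop_op_def by blast
  have fd: "finite_dimC (weight_vectors h a c)" for a c
    by (rule finite_dim_weight_vectors) (rule assms(10))
  obtain \<mu> v where v: "v \<in> weight_space \<rho> (tau_H h) \<mu>" "v \<noteq> 0"
    by (rule weight_vector_exists[OF assms(8,9)]) (rule that)
  define a where "a z = \<mu> (loop_elt z (t_mono 0) 1)" for z
  define c where "c i = \<mu> (d_elt i)" for i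
  have "loop_elt z (t_mono 0) 1 \<in> (tau_H h :: ('g, 'n, 'b) tau set)" if "z \<in> h" for z
    using that unfolding tau_H_def by (intro cvs.span_base) blast
  moreover have "d_elt i \<in> (tau_H h :: ('g, 'n, 'b) tau set)" for i
    unfolding tau_H_def by (intro cvs.span_base) blast
  ultimately have va: "v \<in> weight_vectors h a c"
    using v(1) by (simp add: weight_vectors_def weight_space_def loop_op_def a_def c_def)
  show ?thesis
  proof (cases "Re (a t) \<ge> 0")
    case True
    interpret root_triple_module form \<rho> h \<theta> e f t
      by unfold_locales (fact t f(1) e' nilpotent[OF \<theta> e] nilpotent[OF \<theta>' f_root] fd)+
    show ?thesis
      by (rule Z_tensor_B_trivial_if_dominant[OF assms(8) va v(2) True])
  next
    case False
    have 1: "lie f e = - t"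
      using t(2) lie_antisym[OF inv, of f e] by simp
    have 2: "- t \<in> h"
      by (rule cvs.subspace_neg[OF sub t(1)])
    have "\<theta> ((-1) *\<^sub>C t) = (-1) * \<theta> t"
      using \<theta> t(1) unfolding roots_def cdual_def by blast
    then have 3: "- \<theta> (- t) = 2"
      using t(4) by simp
    have 4: "form f e = 1"
      using t(3) form_sym[OF inv, of f e] by simp
    have 5: "lie z e = - (- \<theta> z) *\<^sub>C e" if "z \<in> h" for z
      using e'[OF that] by simp
    interpret root_triple_module form \<rho> h "\<lambda>z. - \<theta> z" f e "- t"
      by unfold_locales (fact 1 2 3 4 5 f(1) nilpotent[OF \<theta> e] nilpotent[OF \<theta>' f_root] fd)+
    have "loop_op (- t) 0 1 v = - loop_op t 0 1 v"
      using loop_op_scale[of "-1" t 0 1 v] by simp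
    then have "a (- t) *\<^sub>C v = (- a t) *\<^sub>C v"
      using va t(1) 2 by (simp add: weight_vectors_def)
    then have "a (- t) = - a t"
      using v(2) by (simp only: cvs.scale_cancel_right) simp
    then have "Re (a (- t)) \<ge> 0"
      using False by simp
    then show ?thesis
      by (rule Z_tensor_B_trivial_if_dominant[OF assms(8) va v(2)])
  qed
qed

end
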